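(* Let $G=\langle g_i : i\in I\rangle$ be a rational semigroup generated by the nonconstant rational maps $\{g_i : i \in I\}$ ($I$ an arbitrary index set), and assume $G$ is non-elementary. Suppose there is a constant $C<+\infty$ with $\operatorname{Lip} g_i \le C$ for all $i\in I$. Then the Julia set $J(G)$ is uniformly perfect.
   Context: A rational semigroup is a semigroup of nonconstant rational functions on the Riemann sphere $\overline{\mathbb{C}}$ under composition; $\langle g_i : i\in I\rangle$ denotes the semigroup generated by the $g_i$ (all finite compositions of them). No restriction on degrees is made (degree-one maps are allowed). The Fatou set $N(G)$ is the set of $z\in\overline{\mathbb{C}}$ having a neighborhood on which $G$ is a normal family, and the Julia set is $J(G)=\overline{\mathbb{C}}\setminus N(G)$. $G$ is called non-elementary if $J(G)$ contains at least three points. For a rational map $g$, $\operatorname{Lip} g=\inf\{M : \sigma(g(z),g(w))\le M\sigma(z,w)\ \text{for all } z,w\in\overline{\mathbb{C}}\}$, where $\sigma$ is the spherical metric. A conformal annulus is an open set $\mathcal{A}\subset\overline{\mathbb{C}}$ conformally equivalent to some $\{z : r_1<|z|<r_2\}$ with $0\le r_1<r_2\le\infty$; its modulus is $\frac{1}{2\pi}\log(r_2/r_1)$. A conformal annulus $\mathcal{A}$ separates a set $F$ if $F\cap\mathcal{A}=\emptyset$ and $F$ meets both components of $\overline{\mathbb{C}}\setminus\mathcal{A}$. A compact set $F\subset\overline{\mathbb{C}}$ is uniformly perfect if it has at least two points and there is a uniform upper bound on the moduli of all conformal annuli in $\overline{\mathbb{C}}\setminus F$ that separate $F$. *)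

theory Defs
  imports "HOL-Analysis.Analysis" "HOL-Computational_Algebra.Polynomial_Factorial"
begin

text \<open>The Riemann sphere is modelled as the type complex option, where None is the
point at infinity and Some z is the finite point z.\<close>

type_synonym sphere = "complex option"

fun sdist :: "sphere \<Rightarrow> sphere \<Rightarrow> real" where
  "sdist (Some z) (Some w) = 2 * cmod (z - w) / sqrt ((1 + (cmod z)\<^sup>2) * (1 + (cmod w)\<^sup>2))"
| "sdist (Some z) None = 2 / sqrt (1 + (cmod z)\<^sup>2)"
| "sdist None (Some w) = 2 / sqrt (1 + (cmod w)\<^sup>2)"
| "sdist None None = 0"

definition sph_open :: "sphere set \<Rightarrow> bool" where
  "sph_open U \<longleftrightarrow> (\<forall>z\<in>U. \<exists>e>0. \<forall>w. sdist z w < e \<longrightarrow> w \<in> U)"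

definition sph_top :: "sphere topology" where
  "sph_top = topology sph_open"

definition rat_eval :: "complex poly \<Rightarrow> complex poly \<Rightarrow> sphere \<Rightarrow> sphere" where
  "rat_eval p q z = (case z of
      Some a \<Rightarrow> (if poly q a \<noteq> 0 then Some (poly p a / poly q a) else None)
    | None \<Rightarrow> (if degree p > degree q then None
               else if degree p = degree q then Some (lead_coeff p / lead_coeff q)
               else Some 0))"

definition nonconst_rational_map :: "(sphere \<Rightarrow> sphere) \<Rightarrow> bool" where
  "nonconst_rational_map f \<longleftrightarrow>
     (\<exists>p q. q \<noteq> 0 \<and> coprime p q \<and> max (degree p) (degree q) \<ge> 1 \<and> f = rat_eval p q)"

inductive_set gen_semigroup :: "('i \<Rightarrow> 'a \<Rightarrow> 'a) \<Rightarrow> 'i set \<Rightarrow> ('a \<Rightarrow> 'a) set"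
  for g :: "'i \<Rightarrow> 'a \<Rightarrow> 'a" and I :: "'i set" where
  gen: "i \<in> I \<Longrightarrow> g i \<in> gen_semigroup g I"
| comp: "f \<in> gen_semigroup g I \<Longrightarrow> h \<in> gen_semigroup g I \<Longrightarrow> f \<circ> h \<in> gen_semigroup g I"

definition normal_on :: "(sphere \<Rightarrow> sphere) set \<Rightarrow> sphere set \<Rightarrow> bool" where
  "normal_on G U \<longleftrightarrow>
     (\<forall>f :: nat \<Rightarrow> sphere \<Rightarrow> sphere. (\<forall>n. f n \<in> G) \<longrightarrow>
        (\<exists>(r :: nat \<Rightarrow> nat) \<phi>. strict_mono r \<and>
           (\<forall>z\<in>U. \<exists>V. openin sph_top V \<and> z \<in> V \<and> V \<subseteq> U \<and>
              (\<forall>e>0. \<exists>N. \<forall>n\<ge>N. \<forall>w\<in>V. sdist (f (r n) w) (\<phi> w) < e))))"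

definition fatou_set :: "(sphere \<Rightarrow> sphere) set \<Rightarrow> sphere set" where
  "fatou_set G = {z. \<exists>U. openin sph_top U \<and> z \<in> U \<and> normal_on G U}"

definition julia_set :: "(sphere \<Rightarrow> sphere) set \<Rightarrow> sphere set" where
  "julia_set G = UNIV - fatou_set G"

definition non_elementary :: "(sphere \<Rightarrow> sphere) set \<Rightarrow> bool" where
  "non_elementary G \<longleftrightarrow>
     (\<exists>a b c. a \<in> julia_set G \<and> b \<in> julia_set G \<and> c \<in> julia_set G \<and>
              a \<noteq> b \<and> a \<noteq> c \<and> b \<noteq> c)"

definition Lip :: "(sphere \<Rightarrow> sphere) \<Rightarrow> real" where
  "Lip g = Inf {M. \<forall>z w. sdist (g z) (g w) \<le> M * sdist z w}"

definition sph_holomorphic_on :: "(complex \<Rightarrow> sphere) \<Rightarrow> complex set \<Rightarrow> bool" where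
  "sph_holomorphic_on \<phi> R \<longleftrightarrow>
     (\<forall>z\<in>R. \<exists>e>0. ball z e \<subseteq> R \<and>
        (((\<forall>w\<in>ball z e. \<phi> w \<noteq> None) \<and> (\<lambda>w. the (\<phi> w)) holomorphic_on ball z e) \<or>
         ((\<forall>w\<in>ball z e. \<phi> w \<noteq> Some 0) \<and>
          (\<lambda>w. case \<phi> w of None \<Rightarrow> 0 | Some u \<Rightarrow> 1 / u) holomorphic_on ball z e)))"

definition round_annulus :: "ereal \<Rightarrow> ereal \<Rightarrow> complex set" where
  "round_annulus r1 r2 = {z. r1 < ereal (cmod z) \<and> ereal (cmod z) < r2}"

definition conformal_annulus :: "sphere set \<Rightarrow> ereal \<Rightarrow> ereal \<Rightarrow> bool" where
  "conformal_annulus A r1 r2 \<longleftrightarrow>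
     openin sph_top A \<and> 0 \<le> r1 \<and> r1 < r2 \<and>
     (\<exists>\<phi>. bij_betw \<phi> (round_annulus r1 r2) A \<and> sph_holomorphic_on \<phi> (round_annulus r1 r2))"

definition annulus_modulus :: "ereal \<Rightarrow> ereal \<Rightarrow> ereal" where
  "annulus_modulus r1 r2 =
     (if r1 = 0 \<or> r2 = \<infinity> then \<infinity>
      else ereal (ln (real_of_ereal r2 / real_of_ereal r1) / (2 * pi)))"

text \<open>A separates F: A misses F and F meets both components of the complement of A,
i.e. F contains two points of the complement lying in different components.\<close>
definition separates :: "sphere set \<Rightarrow> sphere set \<Rightarrow> bool" where
  "separates A F \<longleftrightarrow>
     F \<inter> A = {} \<and>
     (\<exists>x\<in>F. \<exists>y\<in>F. \<not> connected_component_of (subtopology sph_top (UNIV - A)) x y)"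

definition uniformly_perfect :: "sphere set \<Rightarrow> bool" where
  "uniformly_perfect F \<longleftrightarrow>
     compactin sph_top F \<and> (\<exists>x\<in>F. \<exists>y\<in>F. x \<noteq> y) \<and>
     (\<exists>M::real. \<forall>A r1 r2. conformal_annulus A r1 r2 \<and> separates A F \<longrightarrow>
                             annulus_modulus r1 r2 \<le> ereal M)"

end

theory Submission
  imports Defs "HOL-Complex_Analysis.Complex_Analysis"
begin

text \<open>
  Fix three points a, b, c of the Julia set J and let A be an annulus of large modulus that
  separates J, with core curve \<open>\<Gamma>\<close>. Every f in G, and also the identity, maps A into the complement
  of J, so by Schottky's theorem f maps \<open>\<Gamma>\<close> into a chordal ball of small radius \<open>\<eta>\<close>. The
  complement of \<open>\<Gamma>\<close> splits into two open sets that both meet J; since the complement of a ball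
  is connected, one of them, W, lies in a small ball.

  By induction on words, f(W) lies in a ball of radius \<open>\<eta>\<close> for all f in G: if h(W) is that small
  and f is h followed by a generator, then f(W) has diameter less than the mutual distances of
  a, b, c by the Lipschitz bound, whereas f(W) is open with frontier in f(\<open>\<Gamma>\<close>), so it is either
  contained in the ball around f(\<open>\<Gamma>\<close>) or contains the complement of that ball, hence two of the
  three points. Therefore G is normal on W by Montel's theorem, although W meets J.
\<close>

subsection \<open>The chordal metric on the Riemann sphere\<close>

text \<open>The Lipschitz bound compounds along a word, so by itself it controls nothing uniformly
  over G; the Schottky bound is uniform over all words, but holds only on the core curve. They are
  combined so that no error accumulates: one generator turns a set inside a ball of radius
  \<open>\<eta>\<close> into a set of diameter at most \<open>D * (2 * \<eta>)\<close>, and this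
  crude bound only has to rule out the large alternative, after which the topology of the sphere
  restores the radius \<open>\<eta>\<close> itself. Hence \<open>\<eta>\<close> depends on the
  generators only through \<open>C\<close>, and not on the length of the word. Three points matter
  twice: as omitted values in Schottky's theorem, and in the alternative, where of two points f(W)
  could contain exactly one without contradiction. All estimates are chordal because words may take
  the value infinity anywhere. Homogeneous coordinates, together with rotations that move a chosen
  point to 0 or infinity, keep case distinctions at infinity out of the argument.\<close>

definition stereo :: "sphere \<Rightarrow> complex \<times> real" where
  "stereo s = (case s of None \<Rightarrow> (0, 1)
     | Some z \<Rightarrow> (of_real (2 / (1 + (cmod z)\<^sup>2)) * z, 1 - 2 / (1 + (cmod z)\<^sup>2)))"

lemma sum_squares_pos1: "1 + (cmod z)\<^sup>2 > 0"
  by (smt (verit) zero_le_power2)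

text \<open>Stereographic projection makes the chordal formula a Euclidean distance, so that the
  triangle inequality, compactness and connectedness are inherited from the unit sphere in C x
  R.\<close>

lemma dist_stereo: "dist (stereo s) (stereo t) = sdist s t"
proof -
  have fin: "dist (stereo (Some z)) (stereo (Some w)) = sdist (Some z) (Some w)" for z w
  proof -
    define A B where "A = 1 + (cmod z)\<^sup>2" and "B = 1 + (cmod w)\<^sup>2"
    have pos: "A > 0" "B > 0"
      by (simp_all add: A_def B_def sum_squares_pos1)
    have A: "(Re z)\<^sup>2 + (Im z)\<^sup>2 = A - 1" and B: "(Re w)\<^sup>2 + (Im w)\<^sup>2 = B - 1"
      by (simp_all add: A_def B_def cmod_power2)
    \<comment> \<open>The relations \<open>a * A = 2\<close> and \<open>b * B = 2\<close> clear all
      denominators: both squared distances reduce to \<open>a * b\<close> times the squared modulus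
      of \<open>z - w\<close>.\<close>
    define a b where "a = 2 / A" and "b = 2 / B"
    have ab: "a * A = 2" "b * B = 2"
      using pos by (simp_all add: a_def b_def)
    have "(dist (stereo (Some z)) (stereo (Some w)))\<^sup>2
        = (cmod (of_real a * z - of_real b * w))\<^sup>2 + (b - a)\<^sup>2"
      by (simp add: stereo_def dist_prod_def dist_norm A_def B_def a_def b_def)
    also have "(cmod (of_real a * z - of_real b * w))\<^sup>2
        = a\<^sup>2 * ((Re z)\<^sup>2 + (Im z)\<^sup>2) + b\<^sup>2 * ((Re w)\<^sup>2 + (Im w)\<^sup>2) - 2 * a * b * (Re z * Re w + Im z * Im w)"
      by (simp add: cmod_power2) algebra
    also have "\<dots> = a\<^sup>2 * (A - 1) + b\<^sup>2 * (B - 1) - 2 * a * b * (Re z * Re w + Im z * Im w)"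
      by (simp only: A B)
    also have "\<dots> + (b - a)\<^sup>2 = a * b * (A + B - 2 - 2 * (Re z * Re w + Im z * Im w))"
    proof -
      have "a\<^sup>2 * (A - 1) = 2 * a - a\<^sup>2" "b\<^sup>2 * (B - 1) = 2 * b - b\<^sup>2"
        using ab by (simp_all add: power2_eq_square algebra_simps)
      moreover have "a * b * A = 2 * b" "a * b * B = 2 * a"
        using ab by simp_all
      moreover have "a * b * (A + B - 2 - 2 * X) = a * b * A + a * b * B - 2 * a * b * (1 + X)" for X
        by (simp add: algebra_simps)
      moreover have "2 * a - a\<^sup>2 + (2 * b - b\<^sup>2) - 2 * a * b * X + (b - a)\<^sup>2
          = 2 * b + 2 * a - 2 * a * b * (1 + X)" for X
        by (simp add: algebra_simps power2_diff)
      ultimately show ?thesis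
        by presburger
    qed
    also have "A + B - 2 - 2 * (Re z * Re w + Im z * Im w) = (cmod (z - w))\<^sup>2"
      using A B by (simp add: cmod_power2 power2_diff algebra_simps)
    also have "a * b * (cmod (z - w))\<^sup>2 = (sdist (Some z) (Some w))\<^sup>2"
      using pos by (simp add: a_def b_def flip: A_def B_def)
        (simp add: power_divide power_mult_distrib real_sqrt_mult)
    finally show ?thesis
      using pos by (subst (asm) power2_eq_iff_nonneg) (auto simp flip: A_def B_def)
  qed
  have inf: "dist (stereo (Some z)) (stereo None) = sdist (Some z) None" for z
  proof -
    define A where "A = 1 + (cmod z)\<^sup>2"
    have pos: "A > 0"
      by (simp add: A_def sum_squares_pos1)
    have "(dist (stereo (Some z)) (stereo None))\<^sup>2 = (2/A)\<^sup>2 * (A - 1) + (2/A)\<^sup>2"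
    proof -
      have "(dist (stereo (Some z)) (stereo None))\<^sup>2 = (cmod (of_real (2/A) * z))\<^sup>2 + (2/A)\<^sup>2"
        by (simp add: stereo_def dist_prod_def dist_norm A_def)
      also have "cmod (of_real (2/A) * z) = 2/A * cmod z"
        using pos by (simp add: norm_mult norm_divide)
      finally show ?thesis
        by (simp only: power_mult_distrib) (simp add: A_def)
    qed
    also have "\<dots> = (sdist (Some z) None)\<^sup>2"
      using pos by (simp flip: A_def) (simp add: field_simps power2_eq_square)
    finally show ?thesis
      using pos by (subst (asm) power2_eq_iff_nonneg) (auto simp flip: A_def)
  qed
  show ?thesis
    using fin inf by (cases s; cases t) (auto simp: dist_commute[of "stereo None"])
qed

lemma stereo_surj: "stereo ` UNIV = sphere 0 1"
proof
  have "dist 0 (stereo s) = 1" for s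
  proof (cases s)
    case (Some z)
    define A where "A = 1 + (cmod z)\<^sup>2"
    have pos: "A > 0"
      by (simp add: A_def sum_squares_pos1)
    have "(norm (stereo s))\<^sup>2 = (2/A)\<^sup>2 * (A - 1) + (1 - 2/A)\<^sup>2"
    proof -
      have "(norm (stereo s))\<^sup>2 = (cmod (of_real (2/A) * z))\<^sup>2 + (1 - 2/A)\<^sup>2"
        by (simp add: Some stereo_def norm_prod_def A_def)
      also have "cmod (of_real (2/A) * z) = 2/A * cmod z"
        using pos by (simp add: norm_mult norm_divide)
      finally show ?thesis
        by (simp only: power_mult_distrib) (simp add: A_def)
    qed
    also have "\<dots> = 1"
      using pos by (simp add: field_simps power2_eq_square)
    finally show ?thesis
      using power2_eq_iff_nonneg[of "norm (stereo s)" 1] by simp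
  qed (simp add: stereo_def norm_prod_def)
  then show "stereo ` UNIV \<subseteq> sphere 0 1"
    by auto
next
  show "sphere 0 1 \<subseteq> stereo ` UNIV"
  proof
    fix x :: "complex \<times> real" assume "x \<in> sphere 0 1"
    moreover obtain \<zeta> t where x: "x = (\<zeta>, t)" by (cases x)
    ultimately have n: "(cmod \<zeta>)\<^sup>2 + t\<^sup>2 = 1"
      by (simp add: norm_prod_def)
    show "x \<in> stereo ` UNIV"
    proof (cases "t = 1")
      case True
      then have "x = stereo None"
        using n by (simp add: x stereo_def)
      then show ?thesis by blast
    next
      case False
      have "t\<^sup>2 \<le> 1" using n by (smt (verit) zero_le_power2)
      then have t: "1 - t > 0" using False by (simp add: abs_square_le_1)
      \<comment> \<open>Projection from the pole (0, 1), which is itself the image of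
        \<open>None\<close>.\<close>
      define z where "z = \<zeta> / of_real (1 - t)"
      have "cmod z = cmod \<zeta> / (1 - t)"
        using t unfolding z_def norm_divide norm_of_real by simp
      moreover have "(cmod \<zeta>)\<^sup>2 = 1 - t\<^sup>2" using n by simp
      ultimately have "(cmod z)\<^sup>2 = (1 - t\<^sup>2) / (1 - t)\<^sup>2"
        by (simp add: power_divide)
      also have "1 - t\<^sup>2 = (1 - t) * (1 + t)"
        by (simp add: power2_eq_square algebra_simps)
      also have "(1 - t) * (1 + t) / (1 - t)\<^sup>2 = (1 + t) / (1 - t)"
        using t by (simp add: power2_eq_square)
      finally have "1 + (cmod z)\<^sup>2 = 2 / (1 - t)"
        using t by (simp add: field_simps)
      then have "2 / (1 + (cmod z)\<^sup>2) = 1 - t"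
        using t by simp
      then have "stereo (Some z) = x"
        using t False by (simp add: stereo_def x) (simp add: z_def)
      then show ?thesis by blast
    qed
  qed
qed

interpretation sph: Metric_space UNIV sdist
proof
  show "sdist x y = 0 \<longleftrightarrow> x = y" for x y
  proof (cases x; cases y)
    fix z w assume "x = Some z" "y = Some w"
    then show ?thesis
      using sum_squares_pos1[of z] sum_squares_pos1[of w] by auto
  qed (auto simp: add_nonneg_eq_0_iff)
qed (simp_all flip: dist_stereo add: dist_commute dist_triangle)

lemma sph_top_eq: "sph_top = sph.mtopology"
proof -
  have "sph_open = openin sph.mtopology"
    by (auto simp: sph_open_def sph.openin_mtopology fun_eq_iff subset_iff)
  then show ?thesis
    unfolding sph_top_def by (metis openin_inverse)
qed

lemma topspace_sph [simp]: "topspace sph_top = UNIV"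
  by (simp add: sph_top_eq)

lemma openin_sph: "openin sph_top U \<longleftrightarrow> (\<forall>z\<in>U. \<exists>e>0. \<forall>w. sdist z w < e \<longrightarrow> w \<in> U)"
  by (auto simp: sph_top_eq sph.openin_mtopology subset_iff)

lemma Hausdorff_sph: "Hausdorff_space sph_top"
  by (simp add: sph_top_eq sph.Hausdorff_space_mtopology)

lemma normal_sph: "normal_space sph_top"
  by (simp add: sph_top_eq sph.normal_space_mtopology)

lemma sph_homeomorphic: "sph_top homeomorphic_space top_of_set (sphere (0::complex \<times> real) 1)"
proof -
  have eq: "sdist s t < e \<longleftrightarrow> dist (stereo s) (stereo t) < e" for s t e
    by (simp add: dist_stereo)
  have inj: "inj stereo"
  proof (rule injI)
    fix s t assume "stereo s = stereo t"
    then have "sdist s t = 0" by (simp flip: dist_stereo)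
    then show "s = t" by simp
  qed
  have "homeomorphic_map sph_top (top_of_set (sphere 0 1)) stereo"
    unfolding homeomorphic_eq_everything_map
  proof (intro conjI)
    show "open_map sph_top (top_of_set (sphere (0::complex \<times> real) 1)) stereo"
      unfolding open_map_def openin_sph openin_euclidean_subtopology_iff
      using stereo_surj by (fastforce simp: eq dist_commute)
    moreover show "continuous_map sph_top (top_of_set (sphere (0::complex \<times> real) 1)) stereo"
      unfolding continuous_map_def openin_sph openin_euclidean_subtopology_iff
      using stereo_surj by (fastforce simp: eq dist_commute)
    moreover show "closed_map sph_top (top_of_set (sphere (0::complex \<times> real) 1)) stereo"
      using calculation inj stereo_surj
      by (intro bijective_open_imp_closed_map) auto
  qed (use stereo_surj inj in auto)
  then show ?thesis
    by (rule homeomorphic_map_imp_homeomorphic_space)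
qed

lemma compact_sph: "compact_space sph_top"
  using homeomorphic_compact_space[OF sph_homeomorphic]
  by (simp add: compact_space_subtopology)

lemma connected_sph: "connected_space sph_top"
proof -
  have "connected (sphere (0::complex \<times> real) 1)"
    by (rule connected_sphere) simp
  then show ?thesis
    using homeomorphic_connected_space[OF sph_homeomorphic]
    by (metis connectedin_iff_connected connectedin_def)
qed

subsection \<open>Homogeneous coordinates and rational maps\<close>

text \<open>The point [u : v] of the projective line. The pair (0, 0) is no point and gets the
  default value \<open>None\<close>, which is why later facts ask for a nonzero pair.\<close>

definition hpt :: "complex \<Rightarrow> complex \<Rightarrow> sphere" where
  "hpt u v = (if v = 0 then None else Some (u / v))"

lemma hpt_surj: obtains u v where "s = hpt u v" "(cmod u)\<^sup>2 + (cmod v)\<^sup>2 = 1"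
proof (cases s)
  case None
  then show ?thesis using that[of 1 0] by (simp add: hpt_def)
next
  case (Some z)
  define r where "r = sqrt (1 + (cmod z)\<^sup>2)"
  have r: "r > 0" "r\<^sup>2 = 1 + (cmod z)\<^sup>2"
    using sum_squares_pos1[of z] by (simp_all add: r_def)
  show ?thesis
  proof (rule that)
    show "s = hpt (z / of_real r) (1 / of_real r)"
      using r Some by (simp add: hpt_def)
    show "(cmod (z / of_real r))\<^sup>2 + (cmod (1 / of_real r))\<^sup>2 = 1"
      using r sum_squares_pos1[of z] by (simp add: norm_divide power_divide flip: add_divide_distrib)
  qed
qed

lemma hpt_scale: "c \<noteq> 0 \<Longrightarrow> hpt (c * u) (c * v) = hpt u v"
  by (simp add: hpt_def)

lemma hpt_Some [simp]: "hpt z 1 = Some z" "hpt 1 0 = None"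
  by (simp_all add: hpt_def)

text \<open>The chordal distance is a normalized 2 x 2 determinant, in which infinity plays no
  special role. Lipschitz bounds and Moebius isometries are read off from this form.\<close>

lemma sdist_hpt:
  assumes "u \<noteq> 0 \<or> v \<noteq> 0" "u' \<noteq> 0 \<or> v' \<noteq> 0"
  shows "sdist (hpt u v) (hpt u' v') = 2 * cmod (u * v' - u' * v) /
     (sqrt ((cmod u)\<^sup>2 + (cmod v)\<^sup>2) * sqrt ((cmod u')\<^sup>2 + (cmod v')\<^sup>2))"
proof -
  have s: "sqrt (1 + (cmod (x/y))\<^sup>2) = sqrt ((cmod x)\<^sup>2 + (cmod y)\<^sup>2) / cmod y" if "y \<noteq> 0" for x y
  proof -
    have "1 + (cmod (x/y))\<^sup>2 = ((cmod x)\<^sup>2 + (cmod y)\<^sup>2) / (cmod y)\<^sup>2"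
      using that by (simp add: norm_divide field_simps)
    then show ?thesis by (simp add: real_sqrt_divide)
  qed
  have d: "cmod (u/v - u'/v') = cmod (u * v' - u' * v) / (cmod v * cmod v')" if "v \<noteq> 0" "v' \<noteq> 0"
    using that by (simp add: diff_frac_eq norm_divide norm_mult)
  consider "v = 0" "v' = 0" | "v = 0" "v' \<noteq> 0" | "v \<noteq> 0" "v' = 0" | "v \<noteq> 0" "v' \<noteq> 0" by blast
  then show ?thesis
  proof cases
    case 4
    then show ?thesis
      by (simp add: hpt_def real_sqrt_mult s d)
  qed (use assms in \<open>auto simp: hpt_def s norm_mult\<close>)
qed

text \<open>The homogenization of p in degree N, that is, v^N p(u/v) when
  \<open>degree p \<le> N\<close>.\<close>

definition hpoly :: "nat \<Rightarrow> complex poly \<Rightarrow> complex \<Rightarrow> complex \<Rightarrow> complex" where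
  "hpoly N p u v = (\<Sum>k\<le>N. coeff p k * (u ^ k * v ^ (N - k)))"

lemma hpoly_nonzero:
  assumes "degree p \<le> N" "v \<noteq> 0"
  shows "hpoly N p u v = v ^ N * poly p (u / v)"
proof -
  have "poly p (u/v) = (\<Sum>k\<le>N. coeff p k * (u/v) ^ k)"
    unfolding poly_altdef using assms(1)
    by (intro sum.mono_neutral_left) (auto simp: coeff_eq_0)
  then have "v ^ N * poly p (u / v) = (\<Sum>k\<le>N. v ^ N * (coeff p k * (u/v) ^ k))"
    by (simp add: sum_distrib_left)
  also have "\<dots> = hpoly N p u v"
    unfolding hpoly_def
    using assms(2) by (intro sum.cong refl) (auto simp: power_divide power_diff)
  finally show ?thesis by simp
qed

lemma hpoly_zero: "hpoly N p u 0 = coeff p N * u ^ N"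
proof -
  have "hpoly N p u 0 = (\<Sum>k\<le>N. if k = N then coeff p N * u ^ N else 0)"
    unfolding hpoly_def by (intro sum.cong) (auto simp: power_0_left)
  then show ?thesis by simp
qed

text \<open>Expresses that the homogenizations of p and q have only (0, 0) as a common zero; the
  condition on the coefficients at N is the one at infinity. It forces N to be the larger of the two
  degrees.\<close>

definition hgood :: "nat \<Rightarrow> complex poly \<Rightarrow> complex poly \<Rightarrow> bool" where
  "hgood N p q \<longleftrightarrow> degree p \<le> N \<and> degree q \<le> N \<and> (coeff p N \<noteq> 0 \<or> coeff q N \<noteq> 0)
     \<and> (\<forall>z. poly p z \<noteq> 0 \<or> poly q z \<noteq> 0)"

definition hmap :: "nat \<Rightarrow> complex poly \<Rightarrow> complex poly \<Rightarrow> sphere \<Rightarrow> sphere" where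
  "hmap N p q s = (case s of None \<Rightarrow> hpt (coeff p N) (coeff q N) | Some z \<Rightarrow> hpt (poly p z) (poly q z))"

lemma hpoly_no_common_zero:
  assumes "hgood N p q" "u \<noteq> 0 \<or> v \<noteq> 0"
  shows "hpoly N p u v \<noteq> 0 \<or> hpoly N q u v \<noteq> 0"
  using assms by (cases "v = 0") (auto simp: hgood_def hpoly_nonzero hpoly_zero)

lemma hmap_hpt:
  assumes "hgood N p q" "u \<noteq> 0 \<or> v \<noteq> 0"
  shows "hmap N p q (hpt u v) = hpt (hpoly N p u v) (hpoly N q u v)"
proof (cases "v = 0")
  case True
  then show ?thesis
    using assms hpt_scale[of "u ^ N" "coeff p N" "coeff q N"]
    by (simp add: hmap_def hpt_def[of u] hpoly_zero mult.commute)
next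
  case False
  then show ?thesis
    using assms hpt_scale[of "v ^ N"]
    by (simp add: hmap_def hpt_def[of u] hpoly_nonzero hgood_def)
qed

lemma hpoly_Lipschitz:
  obtains K where "K \<ge> 0"
    "\<And>u v u' v'. cmod u \<le> 1 \<Longrightarrow> cmod v \<le> 1 \<Longrightarrow> cmod u' \<le> 1 \<Longrightarrow> cmod v' \<le> 1 \<Longrightarrow>
       cmod (hpoly N p u v - hpoly N p u' v') \<le> K * (cmod (u - u') + cmod (v - v'))"
proof
  \<comment> \<open>Both exponents of a monomial are at most N, and on the closed unit disc a power
    with exponent j is Lipschitz with constant j.\<close>
  define K where "K = (\<Sum>k\<le>N. cmod (coeff p k) * real N)"
  show "K \<ge> 0" by (simp add: K_def sum_nonneg)
  fix u v u' v' :: complex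
  assume b: "cmod u \<le> 1" "cmod v \<le> 1" "cmod u' \<le> 1" "cmod v' \<le> 1"
  have *: "cmod (u ^ k * v ^ j - u' ^ k * v' ^ j) \<le> N * (cmod (u - u') + cmod (v - v'))"
    if "k \<le> N" "j \<le> N" for k j
  proof -
    have "u ^ k * v ^ j - u' ^ k * v' ^ j = u ^ k * (v ^ j - v' ^ j) + v' ^ j * (u ^ k - u' ^ k)"
      by (simp add: algebra_simps)
    also have "cmod \<dots> \<le> cmod (u ^ k) * cmod (v ^ j - v' ^ j) + cmod (v' ^ j) * cmod (u ^ k - u' ^ k)"
      by (metis norm_mult norm_triangle_ineq)
    also have "\<dots> \<le> 1 * (N * cmod (v - v')) + 1 * (N * cmod (u - u'))"
    proof (intro add_mono mult_mono)
      show "cmod (v ^ j - v' ^ j) \<le> N * cmod (v - v')"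
        using norm_power_diff[of v v' j] b that
        by (meson mult_right_mono norm_ge_zero of_nat_mono order_trans)
      show "cmod (u ^ k - u' ^ k) \<le> N * cmod (u - u')"
        using norm_power_diff[of u u' k] b that
        by (meson mult_right_mono norm_ge_zero of_nat_mono order_trans)
    qed (use b in \<open>auto simp: norm_power power_le_one\<close>)
    finally show ?thesis by (simp add: algebra_simps)
  qed
  have "hpoly N p u v - hpoly N p u' v'
      = (\<Sum>k\<le>N. coeff p k * (u ^ k * v ^ (N - k) - u' ^ k * v' ^ (N - k)))"
    by (simp add: hpoly_def right_diff_distrib sum_subtractf)
  also have "cmod \<dots> \<le> (\<Sum>k\<le>N. cmod (coeff p k) * (N * (cmod (u - u') + cmod (v - v'))))"
    by (rule sum_norm_le) (simp add: norm_mult mult_left_mono *)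
  also have "\<dots> = K * (cmod (u - u') + cmod (v - v'))"
    by (simp add: K_def sum_distrib_right mult.assoc)
  finally show "cmod (hpoly N p u v - hpoly N p u' v') \<le> K * (cmod (u - u') + cmod (v - v'))" .
qed

lemma continuous_on_hpoly: "continuous_on S (\<lambda>x. hpoly N p (fst x) (snd x))"
  unfolding hpoly_def by (intro continuous_intros)

text \<open>The unit sphere of C^2 is compact and the two forms have no common zero on it, so the
  minimum of their joint norm is positive.\<close>

lemma hpoly_lower_bound:
  assumes "hgood N p q"
  obtains m where "m > 0"
    "\<And>u v. (cmod u)\<^sup>2 + (cmod v)\<^sup>2 = 1 \<Longrightarrow> m \<le> sqrt ((cmod (hpoly N p u v))\<^sup>2 + (cmod (hpoly N q u v))\<^sup>2)"
proof -
  define F where "F = (\<lambda>x. sqrt ((cmod (hpoly N p (fst x) (snd x)))\<^sup>2 + (cmod (hpoly N q (fst x) (snd x)))\<^sup>2))"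
  have "continuous_on (sphere 0 1) F"
    unfolding F_def by (intro continuous_intros continuous_on_hpoly)
  moreover have "(1, 0) \<in> sphere (0 :: complex \<times> complex) 1"
    by (simp add: norm_prod_def)
  ultimately obtain x where x: "x \<in> sphere 0 1" "\<And>y. y \<in> sphere 0 1 \<Longrightarrow> F x \<le> F y"
    using continuous_attains_inf[of "sphere (0 :: complex \<times> complex) 1" F] by auto
  show ?thesis
  proof (rule that)
    have "fst x \<noteq> 0 \<or> snd x \<noteq> 0"
      using x(1) by (cases x) (auto simp: norm_prod_def)
    from hpoly_no_common_zero[OF assms this] show "F x > 0"
      unfolding F_def by (auto simp: sum_power2_gt_zero_iff)
    show "F x \<le> sqrt ((cmod (hpoly N p u v))\<^sup>2 + (cmod (hpoly N q u v))\<^sup>2)"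
      if "(cmod u)\<^sup>2 + (cmod v)\<^sup>2 = 1" for u v
      using x(2)[of "(u, v)"] that by (simp add: F_def norm_prod_def)
  qed
qed

text \<open>For unit vectors this is sin^2 + cos^2 = 1: the determinant gives the chordal distance,
  the Hermitian product the alignment of the representatives.\<close>

lemma Lagrange_identity_complex:
  "(cmod (u * v' - u' * v))\<^sup>2 + (cmod (u * cnj u' + v * cnj v'))\<^sup>2
    = ((cmod u)\<^sup>2 + (cmod v)\<^sup>2) * ((cmod u')\<^sup>2 + (cmod v')\<^sup>2)"
  unfolding cmod_power2 by simp algebra

text \<open>The phases are aligned so that the Hermitian product of the representatives is nonnegative.\<close>

lemma hpt_aligned:
  obtains u v u' v' where "s = hpt u v" "t = hpt u' v'"
    "(cmod u)\<^sup>2 + (cmod v)\<^sup>2 = 1" "(cmod u')\<^sup>2 + (cmod v')\<^sup>2 = 1"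
    "cmod (u - u') \<le> sdist s t" "cmod (v - v') \<le> sdist s t"
proof -
  obtain u v where 1: "s = hpt u v" "(cmod u)\<^sup>2 + (cmod v)\<^sup>2 = 1"
    using hpt_surj .
  obtain u0 v0 where 2: "t = hpt u0 v0" "(cmod u0)\<^sup>2 + (cmod v0)\<^sup>2 = 1"
    using hpt_surj .
  define c where "c = u * cnj u0 + v * cnj v0"
  \<comment> \<open>If \<open>c = 0\<close> the vectors are orthogonal and any phase will do;
    \<open>sgn 0 = 0\<close> would destroy the representative.\<close>
  define l where "l = (if c = 0 then 1 else sgn c)"
  have l: "cmod l = 1" "l \<noteq> 0" by (auto simp: l_def norm_sgn sgn_zero_iff)
  have cl: "c * cnj l = of_real (cmod c)"
  proof (cases "c = 0")
    case False
    have "c * cnj c = of_real (cmod c) * of_real (cmod c)"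
      by (simp add: complex_norm_square[symmetric] power2_eq_square)
    then show ?thesis
      using False by (simp add: l_def sgn_div_norm scaleR_conv_of_real field_simps)
  qed (simp add: l_def)
  define u' v' where "u' = l * u0" and "v' = l * v0"
  have t: "t = hpt u' v'" using 2 l hpt_scale by (simp add: u'_def v'_def)
  have n: "(cmod u')\<^sup>2 + (cmod v')\<^sup>2 = 1" using 2 l by (simp add: u'_def v'_def norm_mult)
  have in': "u * cnj u' + v * cnj v' = of_real (cmod c)"
    using cl by (simp add: u'_def v'_def c_def algebra_simps)
  have lag: "(cmod (u * v' - u' * v))\<^sup>2 + (cmod c)\<^sup>2 = 1"
    using Lagrange_identity_complex[of u v' u' v] 1 n in' by simp
  then have c1: "cmod c \<le> 1"
    by (metis abs_norm_cancel abs_square_le_1 le_add_same_cancel2 zero_le_power2)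
  have d: "sdist s t = 2 * cmod (u * v' - u' * v)"
  proof -
    have "u \<noteq> 0 \<or> v \<noteq> 0" "u' \<noteq> 0 \<or> v' \<noteq> 0" using 1 n by auto
    from sdist_hpt[OF this] show ?thesis using 1 t n by simp
  qed
  have "(cmod (u - u'))\<^sup>2 + (cmod (v - v'))\<^sup>2
      = ((cmod u)\<^sup>2 + (cmod v)\<^sup>2) + ((cmod u')\<^sup>2 + (cmod v')\<^sup>2) - 2 * Re (u * cnj u' + v * cnj v')"
    unfolding cmod_power2 by simp algebra
  also have "\<dots> = 2 - 2 * cmod c"
    using in' 1 n by simp
  also have "\<dots> \<le> 4 * (1 - (cmod c)\<^sup>2)"
  proof -
    have "(cmod c)\<^sup>2 \<le> cmod c" using c1 by (simp add: power2_eq_square mult_left_le)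
    then show ?thesis using c1 by simp
  qed
  also have "\<dots> = (sdist s t)\<^sup>2"
    using lag d by (simp add: power_mult_distrib)
  finally have "(cmod (u - u'))\<^sup>2 \<le> (sdist s t)\<^sup>2" "(cmod (v - v'))\<^sup>2 \<le> (sdist s t)\<^sup>2"
    by (smt (verit) zero_le_power2)+
  then have "cmod (u - u') \<le> sdist s t" "cmod (v - v') \<le> sdist s t"
    using sph.nonneg by (auto intro: power2_le_imp_le)
  then show ?thesis using that 1 t n by blast
qed

text \<open>The determinant of the image vectors is Lipschitz in aligned representatives, and the
  norms in the denominator are bounded below by compactness. The constant itself is irrelevant: it
  yields continuity, and it shows that the infimum defining \<open>Lip\<close> is over a nonempty
  set.\<close>

lemma hmap_Lipschitz:
  assumes "hgood N p q"
  obtains L where "L > 0" "\<And>s t. sdist (hmap N p q s) (hmap N p q t) \<le> L * sdist s t"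
proof -
  obtain m where m: "m > 0"
    "\<And>u v. (cmod u)\<^sup>2 + (cmod v)\<^sup>2 = 1 \<Longrightarrow> m \<le> sqrt ((cmod (hpoly N p u v))\<^sup>2 + (cmod (hpoly N q u v))\<^sup>2)"
    using hpoly_lower_bound[OF assms] by metis
  obtain K where K: "K \<ge> 0"
    "\<And>u v u' v'. cmod u \<le> 1 \<Longrightarrow> cmod v \<le> 1 \<Longrightarrow> cmod u' \<le> 1 \<Longrightarrow> cmod v' \<le> 1 \<Longrightarrow>
       cmod (hpoly N p u v - hpoly N p u' v') \<le> K * (cmod (u - u') + cmod (v - v'))"
    using hpoly_Lipschitz[of N p] by blast
  obtain K' where K': "K' \<ge> 0"
    "\<And>u v u' v'. cmod u \<le> 1 \<Longrightarrow> cmod v \<le> 1 \<Longrightarrow> cmod u' \<le> 1 \<Longrightarrow> cmod v' \<le> 1 \<Longrightarrow>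
       cmod (hpoly N q u v - hpoly N q u' v') \<le> K' * (cmod (u - u') + cmod (v - v'))"
    using hpoly_Lipschitz[of N q] by blast
  \<comment> \<open>One factor 2 stems from the chordal formula, the other from adding the
    differences of the two coordinates; the norm \<open>a\<close> cancels and \<open>b\<close> is at
    least \<open>m\<close>. The summand 1 makes the constant positive even if \<open>K\<close> and
    \<open>K'\<close> vanish.\<close>
  have "sdist (hmap N p q s) (hmap N p q t) \<le> (4 * (K + K') / m + 1) * sdist s t" for s t
  proof -
    obtain u v u' v' where st: "s = hpt u v" "t = hpt u' v'"
      and n: "(cmod u)\<^sup>2 + (cmod v)\<^sup>2 = 1" and n': "(cmod u')\<^sup>2 + (cmod v')\<^sup>2 = 1"
      and d: "cmod (u - u') \<le> sdist s t" "cmod (v - v') \<le> sdist s t"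
      using hpt_aligned .
    have nz: "u \<noteq> 0 \<or> v \<noteq> 0" "u' \<noteq> 0 \<or> v' \<noteq> 0" using n n' by auto
    have le1: "cmod u \<le> 1" "cmod v \<le> 1" "cmod u' \<le> 1" "cmod v' \<le> 1"
      using n n' by (metis abs_norm_cancel abs_square_le_1 le_add_same_cancel1 le_add_same_cancel2 zero_le_power2)+
    define P Q P' Q' where "P = hpoly N p u v" and "Q = hpoly N q u v"
      and "P' = hpoly N p u' v'" and "Q' = hpoly N q u' v'"
    define a b where "a = sqrt ((cmod P)\<^sup>2 + (cmod Q)\<^sup>2)" and "b = sqrt ((cmod P')\<^sup>2 + (cmod Q')\<^sup>2)"
    have ab: "a > 0" "b \<ge> m"
      using m(2)[OF n] m(2)[OF n'] m(1) unfolding a_def b_def P_def Q_def P'_def Q'_def by linarith+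
    have Pa: "cmod P \<le> a" "cmod Q \<le> a"
      by (auto simp: a_def intro!: real_le_rsqrt)
    have "P * Q' - P' * Q = P * (Q' - Q) + Q * (P - P')"
      by (simp add: algebra_simps)
    also have "cmod \<dots> \<le> cmod P * cmod (Q' - Q) + cmod Q * cmod (P - P')"
      by (metis norm_mult norm_triangle_ineq)
    also have "\<dots> \<le> a * (2 * K' * sdist s t) + a * (2 * K * sdist s t)"
    proof (intro add_mono mult_mono Pa)
      have *: "cmod (u - u') + cmod (v - v') \<le> 2 * sdist s t" using d by simp
      have "cmod (Q' - Q) \<le> K' * (cmod (u - u') + cmod (v - v'))"
        using K'(2)[OF le1] by (simp add: Q_def Q'_def norm_minus_commute)
      also have "\<dots> \<le> K' * (2 * sdist s t)"
        using * K'(1) by (rule mult_left_mono)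
      finally show "cmod (Q' - Q) \<le> 2 * K' * sdist s t" by simp
      have "cmod (P - P') \<le> K * (cmod (u - u') + cmod (v - v'))"
        using K(2)[OF le1] by (simp add: P_def P'_def)
      also have "\<dots> \<le> K * (2 * sdist s t)"
        using * K(1) by (rule mult_left_mono)
      finally show "cmod (P - P') \<le> 2 * K * sdist s t" by simp
    qed (use ab in auto)
    finally have *: "cmod (P * Q' - P' * Q) \<le> a * (2 * (K + K') * sdist s t)"
      by (simp add: algebra_simps)
    have "sdist (hmap N p q s) (hmap N p q t) = sdist (hpt P Q) (hpt P' Q')"
      using nz assms by (simp add: st hmap_hpt P_def Q_def P'_def Q'_def)
    also have "\<dots> = 2 * cmod (P * Q' - P' * Q) / (a * b)"
      unfolding a_def b_def P_def Q_def P'_def Q'_def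
      by (intro sdist_hpt hpoly_no_common_zero assms nz)
    also have "\<dots> \<le> 2 * (a * (2 * (K + K') * sdist s t)) / (a * b)"
      using * ab m(1) by (intro divide_right_mono mult_left_mono) auto
    also have "\<dots> = 4 * (K + K') * sdist s t / b"
      using ab by simp
    also have "\<dots> \<le> 4 * (K + K') * sdist s t / m"
      using ab m(1) K(1) K'(1) by (intro divide_left_mono) auto
    also have "\<dots> \<le> (4 * (K + K') / m + 1) * sdist s t"
      by (simp add: algebra_simps)
    finally show ?thesis .
  qed
  moreover have "4 * (K + K') / m + 1 > 0"
    using m(1) K(1) K'(1) by (intro add_nonneg_pos divide_nonneg_pos) auto
  ultimately show ?thesis using that by blast
qed

lemma rational_map_hmap:
  assumes "nonconst_rational_map f"
  obtains N p q where "f = hmap N p q" "hgood N p q" "\<And>w. finite {z. f z = w}"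
proof -
  obtain p q where q: "q \<noteq> 0" and cop: "coprime p q" and deg: "max (degree p) (degree q) \<ge> 1"
    and f: "f = rat_eval p q"
    using assms unfolding nonconst_rational_map_def by blast
  define N where "N = max (degree p) (degree q)"
  have nocom: "poly p z \<noteq> 0 \<or> poly q z \<noteq> 0" for z
  proof (rule ccontr)
    assume "\<not> ?thesis"
    then have "[:- z, 1:] dvd p" "[:- z, 1:] dvd q"
      by (auto simp: poly_eq_0_iff_dvd)
    then have "is_unit [:- z, 1:]"
      using cop coprime_common_divisor by blast
    then show False by (simp add: is_unit_iff_degree)
  qed
  have lead: "coeff p N \<noteq> 0 \<or> coeff q N \<noteq> 0"
    using q deg unfolding N_def by (metis leading_coeff_0_iff max_def degree_0 not_one_le_zero)
  have "rat_eval p q s = hmap N p q s" for s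
  proof (cases s)
    case None
    then show ?thesis
      using q by (auto simp: rat_eval_def hmap_def hpt_def N_def max_def coeff_eq_0)
  qed (auto simp: rat_eval_def hmap_def hpt_def)
  then have "f = hmap N p q" using f by auto
  moreover have "hgood N p q"
    using nocom lead by (auto simp: hgood_def N_def)
  moreover have "finite {z. f z = w}" for w
  proof -
    \<comment> \<open>The finite solutions of \<open>f z = w\<close> are among the roots of this
      polynomial. It is nonzero because \<open>p = smult c q\<close> and coprimality would make both
      p and q constant.\<close>
    define r where "r = (case w of None \<Rightarrow> q | Some c \<Rightarrow> p - smult c q)"
    have "r \<noteq> 0"
    proof (cases w)
      case (Some c)
      have "p \<noteq> smult c q"
      proof
        assume *: "p = smult c q"
        then have "q dvd p" by (simp add: dvd_smult)
        then have "is_unit q" using coprime_common_divisor[OF cop, of q] by simp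
        then have "degree q = 0" by (simp add: is_unit_iff_degree q)
        then show False using deg * by (simp split: if_splits)
      qed
      then show ?thesis by (simp add: r_def Some)
    qed (simp add: r_def q)
    then have fin: "finite {z. poly r z = 0}" by (rule poly_roots_finite)
    have "{z. f z = w} \<subseteq> insert None (Some ` {z. poly r z = 0})"
    proof
      fix s assume s: "s \<in> {z. f z = w}"
      show "s \<in> insert None (Some ` {z. poly r z = 0})"
      proof (cases s)
        case (Some z)
        then have "poly r z = 0"
          using s by (auto simp: f rat_eval_def r_def field_simps split: if_splits option.splits)
        then show ?thesis using Some by auto
      qed auto
    qed
    then show ?thesis using fin finite_subset by blast
  qed
  ultimately show ?thesis using that by blast
qed

subsection \<open>Maps holomorphic into the sphere\<close>

text \<open>Local homogeneous coordinates replace the two charts. Conversely, one divides by a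
  coordinate that is nonzero at the centre, on a smaller ball. In this form composition with a
  rational map is substitution into two forms.\<close>

lemma sph_holomorphic_on_iff_hpt:
  "sph_holomorphic_on F R \<longleftrightarrow> (\<forall>z\<in>R. \<exists>e>0. ball z e \<subseteq> R \<and> (\<exists>u v.
      u holomorphic_on ball z e \<and> v holomorphic_on ball z e \<and>
      (\<forall>w\<in>ball z e. (u w \<noteq> 0 \<or> v w \<noteq> 0) \<and> F w = hpt (u w) (v w))))"
  (is "_ \<longleftrightarrow> (\<forall>z\<in>R. ?P z)")
proof
  assume L: "sph_holomorphic_on F R"
  show "\<forall>z\<in>R. ?P z"
  proof
    fix z assume "z \<in> R"
    then obtain e where e: "e > 0" "ball z e \<subseteq> R" and
      *: "((\<forall>w\<in>ball z e. F w \<noteq> None) \<and> (\<lambda>w. the (F w)) holomorphic_on ball z e) \<or>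
         ((\<forall>w\<in>ball z e. F w \<noteq> Some 0) \<and>
          (\<lambda>w. case F w of None \<Rightarrow> 0 | Some u \<Rightarrow> 1 / u) holomorphic_on ball z e)"
      using L unfolding sph_holomorphic_on_def by meson
    have "\<exists>u v. u holomorphic_on ball z e \<and> v holomorphic_on ball z e \<and>
      (\<forall>w\<in>ball z e. (u w \<noteq> 0 \<or> v w \<noteq> 0) \<and> F w = hpt (u w) (v w))"
      using *
    proof
      assume h: "(\<forall>w\<in>ball z e. F w \<noteq> None) \<and> (\<lambda>w. the (F w)) holomorphic_on ball z e"
      show ?thesis
        by (rule exI[of _ "\<lambda>w. the (F w)"], rule exI[of _ "\<lambda>w. 1"]) (use h in auto)
    next
      assume h: "(\<forall>w\<in>ball z e. F w \<noteq> Some 0) \<and>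
          (\<lambda>w. case F w of None \<Rightarrow> 0 | Some u \<Rightarrow> 1 / u) holomorphic_on ball z e"
      show ?thesis
        by (rule exI[of _ "\<lambda>w. 1"], rule exI[of _ "\<lambda>w. case F w of None \<Rightarrow> 0 | Some u \<Rightarrow> 1 / u"])
          (use h in \<open>auto simp: hpt_def split: option.splits\<close>)
    qed
    then show "?P z" using e by blast
  qed
next
  assume R: "\<forall>z\<in>R. ?P z"
  show "sph_holomorphic_on F R"
    unfolding sph_holomorphic_on_def
  proof
    fix z assume "z \<in> R"
    then obtain e u v where e: "e > 0" "ball z e \<subseteq> R"
      and hol: "u holomorphic_on ball z e" "v holomorphic_on ball z e"
      and F: "\<And>w. w \<in> ball z e \<Longrightarrow> (u w \<noteq> 0 \<or> v w \<noteq> 0) \<and> F w = hpt (u w) (v w)"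
      using R by meson
    have near: "\<exists>d>0. d \<le> e \<and> (\<forall>w\<in>ball z d. h w \<noteq> 0)"
      if "h holomorphic_on ball z e" "h z \<noteq> 0" for h
    proof -
      have "continuous (at z) h"
        using that(1) e by (metis centre_in_ball continuous_on_interior holomorphic_on_imp_continuous_on interior_open open_ball)
      then obtain d where "d > 0" "\<And>w. dist z w < d \<Longrightarrow> h w \<noteq> 0"
        using continuous_at_avoid[of z h 0] \<open>h z \<noteq> 0\<close> by metis
      then show ?thesis using e by (intro exI[of _ "min d e"]) auto
    qed
    show "\<exists>e>0. ball z e \<subseteq> R \<and>
        (((\<forall>w\<in>ball z e. F w \<noteq> None) \<and> (\<lambda>w. the (F w)) holomorphic_on ball z e) \<or>
         ((\<forall>w\<in>ball z e. F w \<noteq> Some 0) \<and>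
          (\<lambda>w. case F w of None \<Rightarrow> 0 | Some u \<Rightarrow> 1 / u) holomorphic_on ball z e))"
    proof (cases "v z = 0")
      case False
      then obtain d where d: "d > 0" "d \<le> e" "\<And>w. w \<in> ball z d \<Longrightarrow> v w \<noteq> 0"
        using near hol by meson
      have sub: "ball z d \<subseteq> ball z e" using d by auto
      have "(\<lambda>w. u w / v w) holomorphic_on ball z d"
        using hol sub d by (intro holomorphic_intros) (auto intro: holomorphic_on_subset)
      then have "(\<lambda>w. the (F w)) holomorphic_on ball z d"
        using F d sub by (elim holomorphic_transform) (auto simp: hpt_def)
      moreover have "\<forall>w\<in>ball z d. F w \<noteq> None"
        using F d sub by (auto simp: hpt_def)
      ultimately show ?thesis using d e sub by blast
    next
      case True
      then have "u z \<noteq> 0" using F e by auto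
      then obtain d where d: "d > 0" "d \<le> e" "\<And>w. w \<in> ball z d \<Longrightarrow> u w \<noteq> 0"
        using near hol by meson
      have sub: "ball z d \<subseteq> ball z e" using d by auto
      have "(\<lambda>w. v w / u w) holomorphic_on ball z d"
        using hol sub d by (intro holomorphic_intros) (auto intro: holomorphic_on_subset)
      moreover have "v w / u w = (case F w of None \<Rightarrow> 0 | Some u \<Rightarrow> 1 / u)" if "w \<in> ball z d" for w
      proof -
        have "F w = hpt (u w) (v w)" using F sub that by blast
        then show ?thesis by (simp add: hpt_def)
      qed
      ultimately have "(\<lambda>w. case F w of None \<Rightarrow> 0 | Some u \<Rightarrow> 1 / u) holomorphic_on ball z d"
        by (rule holomorphic_transform)
      moreover have "\<forall>w\<in>ball z d. F w \<noteq> Some 0"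
        using F d sub by (auto simp: hpt_def)
      ultimately show ?thesis using d e sub by blast
    qed
  qed
qed

lemma sph_holomorphic_on_hmap:
  assumes "hgood N p q" "sph_holomorphic_on F R"
  shows "sph_holomorphic_on (hmap N p q \<circ> F) R"
  unfolding sph_holomorphic_on_iff_hpt
proof
  fix z assume "z \<in> R"
  then obtain e u v where e: "e > 0" "ball z e \<subseteq> R"
    and hol: "u holomorphic_on ball z e" "v holomorphic_on ball z e"
    and F: "\<And>w. w \<in> ball z e \<Longrightarrow> (u w \<noteq> 0 \<or> v w \<noteq> 0) \<and> F w = hpt (u w) (v w)"
    using assms(2) unfolding sph_holomorphic_on_iff_hpt by meson
  have "(\<lambda>w. hpoly N r (u w) (v w)) holomorphic_on ball z e" for r
    unfolding hpoly_def by (intro holomorphic_intros hol)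
  moreover have "(hpoly N p (u w) (v w) \<noteq> 0 \<or> hpoly N q (u w) (v w) \<noteq> 0) \<and>
      (hmap N p q \<circ> F) w = hpt (hpoly N p (u w) (v w)) (hpoly N q (u w) (v w))"
    if "w \<in> ball z e" for w
    using F[OF that] hpoly_no_common_zero[OF assms(1)] hmap_hpt[OF assms(1)] by force
  ultimately show "\<exists>e>0. ball z e \<subseteq> R \<and> (\<exists>u v.
      u holomorphic_on ball z e \<and> v holomorphic_on ball z e \<and>
      (\<forall>w\<in>ball z e. (u w \<noteq> 0 \<or> v w \<noteq> 0) \<and> (hmap N p q \<circ> F) w = hpt (u w) (v w)))"
    using e by blast
qed

lemma sph_holomorphic_on_Some:
  assumes "h holomorphic_on R" "open R"
  shows "sph_holomorphic_on (\<lambda>w. Some (h w)) R"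
  unfolding sph_holomorphic_on_def
proof
  fix z assume "z \<in> R"
  then obtain e where "e > 0" "ball z e \<subseteq> R" using assms open_contains_ball by blast
  moreover have "h holomorphic_on ball z e"
    using assms calculation by (auto intro: holomorphic_on_subset)
  ultimately show "\<exists>e>0. ball z e \<subseteq> R \<and>
        (((\<forall>w\<in>ball z e. Some (h w) \<noteq> None) \<and> (\<lambda>w. the (Some (h w))) holomorphic_on ball z e) \<or>
         ((\<forall>w\<in>ball z e. Some (h w) \<noteq> Some 0) \<and>
          (\<lambda>w. case Some (h w) of None \<Rightarrow> 0 | Some u \<Rightarrow> 1 / u) holomorphic_on ball z e))"
    by auto
qed

lemma sph_holomorphic_on_subset:
  assumes "sph_holomorphic_on F R" "R' \<subseteq> R" "open R'"
  shows "sph_holomorphic_on F R'"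
  unfolding sph_holomorphic_on_iff_hpt
proof
  fix z assume z: "z \<in> R'"
  then obtain e u v where e: "e > 0" "ball z e \<subseteq> R"
    and hol: "u holomorphic_on ball z e" "v holomorphic_on ball z e"
    and F: "\<And>w. w \<in> ball z e \<Longrightarrow> (u w \<noteq> 0 \<or> v w \<noteq> 0) \<and> F w = hpt (u w) (v w)"
    using assms(1,2) unfolding sph_holomorphic_on_iff_hpt by (meson subsetD)
  obtain d where d: "d > 0" "ball z d \<subseteq> R'" using assms(3) z open_contains_ball by blast
  have sub: "ball z (min d e) \<subseteq> ball z e" "ball z (min d e) \<subseteq> R'" using d by auto
  then show "\<exists>e>0. ball z e \<subseteq> R' \<and> (\<exists>u v.
      u holomorphic_on ball z e \<and> v holomorphic_on ball z e \<and>
      (\<forall>w\<in>ball z e. (u w \<noteq> 0 \<or> v w \<noteq> 0) \<and> F w = hpt (u w) (v w)))"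
    using F d e hol
    by (intro exI[of _ "min d e"] conjI exI[of _ u] exI[of _ v]) (auto intro: holomorphic_on_subset)
qed

lemma sph_holomorphic_on_compose:
  assumes "sph_holomorphic_on F R" "k holomorphic_on S" "open S" "k ` S \<subseteq> R"
  shows "sph_holomorphic_on (F \<circ> k) S"
  unfolding sph_holomorphic_on_iff_hpt
proof
  fix z assume z: "z \<in> S"
  then have "k z \<in> R" using assms(4) by auto
  then obtain e u v where e: "e > 0" "ball (k z) e \<subseteq> R"
    and hol: "u holomorphic_on ball (k z) e" "v holomorphic_on ball (k z) e"
    and F: "\<And>w. w \<in> ball (k z) e \<Longrightarrow> (u w \<noteq> 0 \<or> v w \<noteq> 0) \<and> F w = hpt (u w) (v w)"
    using assms(1) unfolding sph_holomorphic_on_iff_hpt by meson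
  have "open (S \<inter> k -` ball (k z) e)"
    using assms by (intro continuous_open_preimage holomorphic_on_imp_continuous_on) auto
  moreover have "z \<in> S \<inter> k -` ball (k z) e" using z e by auto
  ultimately obtain d where d: "d > 0" "ball z d \<subseteq> S \<inter> k -` ball (k z) e"
    using open_contains_ball by blast
  have "k holomorphic_on ball z d" using d assms by (auto intro: holomorphic_on_subset)
  then have "(u \<circ> k) holomorphic_on ball z d" "(v \<circ> k) holomorphic_on ball z d"
    using hol d by (auto intro!: holomorphic_on_compose_gen[where t="ball (k z) e"])
  moreover have "\<forall>w\<in>ball z d. ((u \<circ> k) w \<noteq> 0 \<or> (v \<circ> k) w \<noteq> 0) \<and> (F \<circ> k) w = hpt ((u \<circ> k) w) ((v \<circ> k) w)"
    using F d by auto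
  ultimately show "\<exists>e>0. ball z e \<subseteq> S \<and> (\<exists>u v.
      u holomorphic_on ball z e \<and> v holomorphic_on ball z e \<and>
      (\<forall>w\<in>ball z e. (u w \<noteq> 0 \<or> v w \<noteq> 0) \<and> (F \<circ> k) w = hpt (u w) (v w)))"
    using d by blast
qed

lemma holomorphic_on_the:
  assumes "sph_holomorphic_on F R" "\<And>z. z \<in> R \<Longrightarrow> F z \<noteq> None" "open R"
  shows "(\<lambda>z. the (F z)) holomorphic_on R"
proof (rule holomorphic_onI)
  fix z assume "z \<in> R"
  then obtain e u v where e: "e > 0" "ball z e \<subseteq> R"
    and hol: "u holomorphic_on ball z e" "v holomorphic_on ball z e"
    and F: "\<And>w. w \<in> ball z e \<Longrightarrow> (u w \<noteq> 0 \<or> v w \<noteq> 0) \<and> F w = hpt (u w) (v w)"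
    using assms(1) unfolding sph_holomorphic_on_iff_hpt by meson
  have nz: "v w \<noteq> 0" if "w \<in> ball z e" for w
    using F[OF that] assms(2)[of w] that e by (auto simp: hpt_def)
  have "(\<lambda>w. u w / v w) holomorphic_on ball z e"
    using hol nz by (intro holomorphic_intros) auto
  then have "(\<lambda>w. the (F w)) holomorphic_on ball z e"
    using F nz by (elim holomorphic_transform) (auto simp: hpt_def)
  then show "(\<lambda>z. the (F z)) field_differentiable at z within R"
    using e by (meson centre_in_ball field_differentiable_at_within holomorphic_on_imp_differentiable_at open_ball)
qed

lemma sph_holomorphic_on_continuous:
  assumes "sph_holomorphic_on F R" "z \<in> R" "e > 0"
  obtains d where "d > 0" "\<And>w. dist z w < d \<Longrightarrow> w \<in> R \<and> sdist (F z) (F w) < e"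
proof -
  obtain r u v where r: "r > 0" "ball z r \<subseteq> R"
    and hol: "u holomorphic_on ball z r" "v holomorphic_on ball z r"
    and F: "\<And>w. w \<in> ball z r \<Longrightarrow> (u w \<noteq> 0 \<or> v w \<noteq> 0) \<and> F w = hpt (u w) (v w)"
    using assms unfolding sph_holomorphic_on_iff_hpt by meson
  define D where "D = (\<lambda>w. 2 * cmod (u z * v w - u w * v z) /
     (sqrt ((cmod (u z))\<^sup>2 + (cmod (v z))\<^sup>2) * sqrt ((cmod (u w))\<^sup>2 + (cmod (v w))\<^sup>2)))"
  have D: "sdist (F z) (F w) = D w" if "w \<in> ball z r" for w
    using F[of z] F[OF that] r unfolding D_def by (simp add: sdist_hpt)
  have "continuous_on (ball z r) D"
    unfolding D_def using F r
    by (intro continuous_intros holomorphic_on_imp_continuous_on hol) (auto simp: sum_power2_eq_zero_iff)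
  then have "continuous (at z) D"
    using r by (simp add: continuous_on_eq_continuous_at)
  then obtain d where d: "d > 0" "\<And>w. dist w z < d \<Longrightarrow> dist (D w) (D z) < e"
    using assms(3) unfolding continuous_at by (auto simp: Lim_at)
      (metis continuous_at_eps_delta \<open>continuous (at z) D\<close> dist_norm)
  have "D z = 0" by (simp add: D_def)
  show ?thesis
  proof (rule that)
    show "min d r > 0" using d r by simp
    show "w \<in> R \<and> sdist (F z) (F w) < e" if "dist z w < min d r" for w
      using that r d(2)[of w] D[of w] \<open>D z = 0\<close> by (auto simp: dist_commute dist_norm)
  qed
qed

lemma continuous_map_sph_holomorphic:
  assumes "sph_holomorphic_on F R"
  shows "continuous_map (top_of_set R) sph_top F"
  unfolding continuous_map_def
proof (intro conjI allI impI)
  fix U assume U: "openin sph_top U"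
  show "openin (top_of_set R) {x \<in> topspace (top_of_set R). F x \<in> U}"
    unfolding openin_euclidean_subtopology_iff
  proof (intro conjI ballI)
    fix z assume z: "z \<in> {x \<in> topspace (top_of_set R). F x \<in> U}"
    then obtain e where e: "e > 0" "\<And>w. sdist (F z) w < e \<Longrightarrow> w \<in> U"
      using U unfolding openin_sph by blast
    obtain d where "d > 0" "\<And>w. dist z w < d \<Longrightarrow> w \<in> R \<and> sdist (F z) (F w) < e"
      using sph_holomorphic_on_continuous[OF assms _ e(1), of z] z by auto
    then show "\<exists>d>0. \<forall>x'\<in>R. dist x' z < d \<longrightarrow> x' \<in> {x \<in> topspace (top_of_set R). F x \<in> U}"
      using e by (metis (mono_tags, lifting) dist_commute mem_Collect_eq topspace_euclidean_subtopology)
  qed auto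
qed auto

lemma openin_sph_Some:
  assumes "open U"
  shows "openin sph_top (Some ` U)"
  unfolding openin_sph
proof
  fix s assume "s \<in> Some ` U"
  then obtain a where a: "s = Some a" "a \<in> U" by blast
  then obtain d where d: "d > 0" "ball a d \<subseteq> U" using assms open_contains_ball by blast
  define A where "A = sqrt (1 + (cmod a)\<^sup>2)"
  have A: "A > 0" using sum_squares_pos1[of a] by (simp add: A_def)
  \<comment> \<open>The bound 1/A excludes infinity, which is at distance 2/A from
    \<open>Some a\<close>, and lets one \<open>cmod (a - b)\<close> be absorbed on the left below;
    the second bound makes the remaining term at most d.\<close>
  define e where "e = min (1/A) (d / (A * (1 + cmod a)))"
  have e: "e > 0" using A d by (simp add: e_def add_pos_nonneg)
  have eA: "e * A \<le> 1" using A by (auto simp: e_def min_def field_simps)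
  have eA2: "e * A * (1 + cmod a) \<le> d"
  proof -
    have "e * (A * (1 + cmod a)) \<le> d / (A * (1 + cmod a)) * (A * (1 + cmod a))"
      using A by (intro mult_right_mono) (auto simp: e_def)
    also have "\<dots> = d" using A
      by (metis add_pos_nonneg mult_pos_pos nonzero_eq_divide_eq norm_ge_zero order_less_irrefl zero_less_one)
    finally show ?thesis by (simp add: mult.assoc)
  qed
  have "t \<in> Some ` U" if t: "sdist s t < e" for t
  proof (cases t)
    case None
    then have "2 / A < e" using t a by (simp add: A_def)
    also have "e \<le> 1 / A" by (simp add: e_def)
    finally show ?thesis using A by (simp add: field_simps)
  next
    case (Some b)
    define B where "B = sqrt (1 + (cmod b)\<^sup>2)"
    have B: "B > 0" using sum_squares_pos1[of b] by (simp add: B_def)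
    have "B \<le> 1 + cmod b"
      unfolding B_def by (rule real_le_lsqrt) (auto simp: power2_sum)
    also have "cmod b \<le> cmod a + cmod (a - b)"
      by (metis norm_minus_commute norm_triangle_sub)
    finally have B1: "B \<le> 1 + cmod a + cmod (a - b)" by simp
    have "2 * cmod (a - b) / (A * B) < e"
      using t by (simp add: a Some A_def B_def real_sqrt_mult)
    then have "2 * cmod (a - b) < e * A * B"
      using A B by (simp add: field_simps)
    also have "\<dots> \<le> e * A * (1 + cmod a + cmod (a - b))"
      using B1 e A by (intro mult_left_mono) auto
    also have "\<dots> = e * A * (1 + cmod a) + e * A * cmod (a - b)"
      by (simp add: algebra_simps)
    also have "\<dots> \<le> d + 1 * cmod (a - b)"
      using eA eA2 by (intro add_mono mult_right_mono) auto
    finally have "cmod (a - b) < d" by simp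
    then show ?thesis using d Some by (auto simp: dist_norm)
  qed
  then show "\<exists>e>0. \<forall>w. sdist s w < e \<longrightarrow> w \<in> Some ` U" using e by blast
qed

section \<open>Moebius transformations z -> (a z + b) / (c z + d) and rotations of the
  sphere\<close>

definition mob :: "complex \<Rightarrow> complex \<Rightarrow> complex \<Rightarrow> complex \<Rightarrow> sphere \<Rightarrow> sphere" where
  "mob a b c d = hmap 1 [:b, a:] [:d, c:]"

lemma hgood_mob:
  assumes "a * d - b * c \<noteq> 0"
  shows "hgood 1 [:b, a:] [:d, c:]"
proof -
  have "poly [:b, a:] z \<noteq> 0 \<or> poly [:d, c:] z \<noteq> 0" for z
  proof (rule ccontr)
    assume "\<not> ?thesis"
    then have "b = - (z * a)" "d = - (z * c)" by (auto simp: add_eq_0_iff2)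
    then show False using assms by simp
  qed
  then show ?thesis using assms by (auto simp: hgood_def)
qed

lemma mob_hpt:
  assumes "a * d - b * c \<noteq> 0" "u \<noteq> 0 \<or> v \<noteq> 0"
  shows "mob a b c d (hpt u v) = hpt (a * u + b * v) (c * u + d * v)"
  unfolding mob_def using hmap_hpt[OF hgood_mob[OF assms(1)] assms(2)]
  by (simp add: hpoly_def algebra_simps)

lemma mob_nonzero:
  fixes a b c d u v :: complex
  assumes "a * d - b * c \<noteq> 0" "u \<noteq> 0 \<or> v \<noteq> 0"
  shows "a * u + b * v \<noteq> 0 \<or> c * u + d * v \<noteq> 0"
proof (rule ccontr)
  assume "\<not> ?thesis"
  then have 0: "a * u + b * v = 0" "c * u + d * v = 0" by auto
  have "(a * d - b * c) * u = d * (a * u + b * v) - b * (c * u + d * v)"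
    "(a * d - b * c) * v = a * (c * u + d * v) - c * (a * u + b * v)"
    by (simp_all add: algebra_simps)
  then show False using 0 assms by simp
qed

text \<open>The inner map belongs to the adjugate matrix, so the product is the determinant times
  the identity, and homogeneous coordinates ignore the scalar.\<close>

lemma mob_inverse:
  assumes "a * d - b * c \<noteq> 0"
  shows "mob a b c d (mob d (- b) (- c) a s) = s"
proof -
  obtain u v where s: "s = hpt u v" and "(cmod u)\<^sup>2 + (cmod v)\<^sup>2 = 1" using hpt_surj .
  then have nz: "u \<noteq> 0 \<or> v \<noteq> 0" by auto
  have det: "d * a - (- b) * (- c) \<noteq> 0" using assms by (simp add: mult.commute)
  have "mob a b c d (mob d (- b) (- c) a s)
      = hpt (a * (d * u + (- b) * v) + b * ((- c) * u + a * v)) (c * (d * u + (- b) * v) + d * ((- c) * u + a * v))"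
    unfolding s mob_hpt[OF det nz] by (rule mob_hpt[OF assms mob_nonzero[OF det nz]])
  also have "\<dots> = hpt ((a * d - b * c) * u) ((a * d - b * c) * v)"
    by (simp add: algebra_simps)
  also have "\<dots> = s" using assms s by (simp add: hpt_scale)
  finally show ?thesis .
qed

text \<open>The hypotheses describe \<open>sqrt k\<close> times a unitary matrix: in the chordal
  formula the determinant is multiplied by k and each of the two norms by
  \<open>sqrt k\<close>.\<close>

lemma mob_isometry:
  assumes k: "cmod (a * d - b * c) = k" "k > 0"
    and n: "\<And>u v. (cmod (a * u + b * v))\<^sup>2 + (cmod (c * u + d * v))\<^sup>2 = k * ((cmod u)\<^sup>2 + (cmod v)\<^sup>2)"
  shows "sdist (mob a b c d s) (mob a b c d t) = sdist s t"
proof -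
  obtain u v where s: "s = hpt u v" and n1: "(cmod u)\<^sup>2 + (cmod v)\<^sup>2 = 1" using hpt_surj .
  obtain u' v' where t: "t = hpt u' v'" and n2: "(cmod u')\<^sup>2 + (cmod v')\<^sup>2 = 1" using hpt_surj .
  have nz: "u \<noteq> 0 \<or> v \<noteq> 0" "u' \<noteq> 0 \<or> v' \<noteq> 0" using n1 n2 by auto
  have det: "a * d - b * c \<noteq> 0" using k by auto
  have "(a * u + b * v) * (c * u' + d * v') - (a * u' + b * v') * (c * u + d * v)
      = (a * d - b * c) * (u * v' - u' * v)"
    by (simp add: algebra_simps)
  then have "sdist (mob a b c d s) (mob a b c d t) = 2 * (k * cmod (u * v' - u' * v)) / (sqrt k * sqrt k)"
    unfolding s t mob_hpt[OF det nz(1)] mob_hpt[OF det nz(2)]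
      sdist_hpt[OF mob_nonzero[OF det nz(1)] mob_nonzero[OF det nz(2)]]
    by (simp add: norm_mult k n n1 n2)
  also have "\<dots> = 2 * cmod (u * v' - u' * v)"
    using k by simp
  finally show ?thesis
    using sdist_hpt[OF nz] n1 n2 by (simp add: s t)
qed

lemma rotation_exists:
  obtains a b c d where "a * d - b * c \<noteq> 0" "mob a b c d (Some 0) = p"
    "\<And>s t. sdist (mob a b c d s) (mob a b c d t) = sdist s t"
proof (cases p)
  case None
  show ?thesis
  proof (rule that[of 0 0 1 1])
    show "mob 0 1 1 0 (Some 0) = p"
      using mob_hpt[of 0 0 1 1 0 1] None by simp
    show "sdist (mob 0 1 1 0 s) (mob 0 1 1 0 t) = sdist s t" for s t
      by (rule mob_isometry[of _ _ _ _ 1]) auto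
  qed simp
next
  case (Some \<alpha>)
  \<comment> \<open>The matrix with rows (1, \<alpha>) and (-cnj \<alpha>, 1) has orthogonal rows of
    squared norm k and determinant k, and it sends 0 to \<alpha>.\<close>
  define k where "k = 1 + (cmod \<alpha>)\<^sup>2"
  have k: "k > 0" by (simp add: k_def sum_squares_pos1)
  have det: "1 * 1 - \<alpha> * (- cnj \<alpha>) = of_real k"
    by (simp add: k_def complex_norm_square[symmetric])
  show ?thesis
  proof (rule that[of 1 1 \<alpha> "- cnj \<alpha>"])
    show nz: "1 * 1 - \<alpha> * (- cnj \<alpha>) \<noteq> 0" using det k by simp
    show "mob 1 \<alpha> (- cnj \<alpha>) 1 (Some 0) = p"
      using mob_hpt[OF nz, of 0 1] Some by simp
    show "sdist (mob 1 \<alpha> (- cnj \<alpha>) 1 s) (mob 1 \<alpha> (- cnj \<alpha>) 1 t) = sdist s t" for s t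
    proof (rule mob_isometry[of _ _ _ _ k])
      show "cmod (1 * 1 - \<alpha> * - cnj \<alpha>) = k" using det k by simp
      show "(cmod (1 * u + \<alpha> * v))\<^sup>2 + (cmod (- cnj \<alpha> * u + 1 * v))\<^sup>2
          = k * ((cmod u)\<^sup>2 + (cmod v)\<^sup>2)" for u v
        unfolding k_def cmod_power2 by simp algebra
    qed (use k in auto)
  qed
qed

subsection \<open>Rotations, the open mapping theorem and the Schottky estimate\<close>

text \<open>Holomorphy is tested on holomorphic maps from plane domains, so that no charts are
  needed on the source and closure under composition is immediate.\<close>

definition sph_holomorphic_map :: "(sphere \<Rightarrow> sphere) \<Rightarrow> bool" where
  "sph_holomorphic_map f \<longleftrightarrow> (\<forall>F R. sph_holomorphic_on F R \<longrightarrow> sph_holomorphic_on (f \<circ> F) R)"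

lemma sph_holomorphic_map_comp:
  "sph_holomorphic_map f \<Longrightarrow> sph_holomorphic_map g \<Longrightarrow> sph_holomorphic_map (f \<circ> g)"
  unfolding sph_holomorphic_map_def comp_assoc by blast

lemma sph_holomorphic_map_hmap: "hgood N p q \<Longrightarrow> sph_holomorphic_map (hmap N p q)"
  by (simp add: sph_holomorphic_map_def sph_holomorphic_on_hmap)

lemma sph_holomorphic_map_mob: "a * d - b * c \<noteq> 0 \<Longrightarrow> sph_holomorphic_map (mob a b c d)"
  unfolding mob_def by (intro sph_holomorphic_map_hmap hgood_mob)

text \<open>A holomorphic chordal isometry together with its inverse. Conjugation by it moves a
  local argument to 0 or infinity at no cost in distances.\<close>

definition rotation_pair :: "(sphere \<Rightarrow> sphere) \<Rightarrow> (sphere \<Rightarrow> sphere) \<Rightarrow> bool" where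
  "rotation_pair T T' \<longleftrightarrow> (\<forall>s. T (T' s) = s) \<and> (\<forall>s. T' (T s) = s) \<and>
     (\<forall>s t. sdist (T s) (T t) = sdist s t) \<and> sph_holomorphic_map T \<and> sph_holomorphic_map T'"

lemma rotation_pair_sym:
  assumes "rotation_pair T T'"
  shows "rotation_pair T' T"
proof -
  have *: "\<And>s. T (T' s) = s" "\<And>s t. sdist (T s) (T t) = sdist s t"
    using assms unfolding rotation_pair_def by blast+
  have "sdist (T' s) (T' t) = sdist s t" for s t
    using *(2)[of "T' s" "T' t"] by (simp only: *(1))
  then show ?thesis
    using assms unfolding rotation_pair_def by blast
qed

lemma rotation_pair_comp:
  assumes "rotation_pair T T'" "rotation_pair S S'"
  shows "rotation_pair (T \<circ> S) (S' \<circ> T')"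
proof -
  have T: "\<And>s. T (T' s) = s" "\<And>s. T' (T s) = s" "\<And>s t. sdist (T s) (T t) = sdist s t"
    "sph_holomorphic_map T" "sph_holomorphic_map T'"
    using assms(1) unfolding rotation_pair_def by blast+
  have S: "\<And>s. S (S' s) = s" "\<And>s. S' (S s) = s" "\<And>s t. sdist (S s) (S t) = sdist s t"
    "sph_holomorphic_map S" "sph_holomorphic_map S'"
    using assms(2) unfolding rotation_pair_def by blast+
  show ?thesis
    unfolding rotation_pair_def by (simp add: T S sph_holomorphic_map_comp)
qed

lemma rotation_pair_zero:
  obtains T T' where "rotation_pair T T'" "T (Some 0) = p" "T' p = Some 0"
proof -
  obtain a b c d where det: "a * d - b * c \<noteq> 0" and p: "mob a b c d (Some 0) = p"
    and iso: "\<And>s t. sdist (mob a b c d s) (mob a b c d t) = sdist s t"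
    using rotation_exists[of p] by metis
  have det': "d * a - (- b) * (- c) \<noteq> 0" using det by (simp add: mult.commute)
  have inv: "mob a b c d (mob d (- b) (- c) a s) = s" "mob d (- b) (- c) a (mob a b c d s) = s" for s
    using mob_inverse[OF det] mob_inverse[OF det'] by simp_all
  have rp: "rotation_pair (mob a b c d) (mob d (- b) (- c) a)"
    unfolding rotation_pair_def using inv iso det det' by (simp add: sph_holomorphic_map_mob)
  show ?thesis
    by (rule that[OF rp p]) (use inv p in metis)
qed

lemma rotation_pair_infinity:
  obtains T T' where "rotation_pair T T'" "T None = p" "T' p = None"
proof -
  obtain T T' where T: "rotation_pair T T'" "T (Some 0) = p" "T' p = Some 0"
    using rotation_pair_zero[of p] .
  obtain S S' where S: "rotation_pair S S'" "S (Some 0) = None" "S' None = Some 0"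
    using rotation_pair_zero[of None] .
  show ?thesis
    by (rule that[OF rotation_pair_comp[OF T(1) rotation_pair_sym[OF S(1)]]]) (simp_all add: T S)
qed

lemma openin_rotation_image:
  assumes "rotation_pair T T'" "openin sph_top U"
  shows "openin sph_top (T ` U)"
  unfolding openin_sph
proof
  fix s assume "s \<in> T ` U"
  then obtain x where x: "s = T x" "x \<in> U" by blast
  then obtain e where e: "e > 0" "\<And>w. sdist x w < e \<Longrightarrow> w \<in> U"
    using assms(2) unfolding openin_sph by blast
  have "w \<in> T ` U" if "sdist s w < e" for w
  proof -
    have "sdist x (T' w) < e" using that assms(1) x unfolding rotation_pair_def by metis
    then have "T (T' w) \<in> T ` U" using e by blast
    then show ?thesis using assms(1) by (simp add: rotation_pair_def)
  qed
  then show "\<exists>e>0. \<forall>w. sdist s w < e \<longrightarrow> w \<in> T ` U" using e by blast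
qed

text \<open>After a rotation taking \<open>F z\<close> to 0 the map is finite near z, and the
  classical open mapping theorem applies on a small ball.\<close>

theorem sph_open_mapping:
  assumes F: "sph_holomorphic_on F R"
    and nonconst: "\<And>z r. r > 0 \<Longrightarrow> ball z r \<subseteq> R \<Longrightarrow> \<exists>w\<in>ball z r. F w \<noteq> F z"
    and V: "open V" "V \<subseteq> R"
  shows "openin sph_top (F ` V)"
proof (subst openin_subopen, intro ballI)
  fix s assume "s \<in> F ` V"
  then obtain z where z: "s = F z" "z \<in> V" by blast
  obtain T T' where T: "rotation_pair T T'" "T (Some 0) = F z" "T' (F z) = Some 0"
    using rotation_pair_zero[of "F z"] .
  define H where "H = T' \<circ> F"
  have H: "sph_holomorphic_on H R"
    unfolding H_def using T(1) F by (simp add: rotation_pair_def sph_holomorphic_map_def)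
  have Hz: "H z = Some 0" using T by (simp add: H_def)
  \<comment> \<open>The chordal distance from 0 to infinity is 2, so values closer to 0 than that
    are finite.\<close>
  obtain d where d: "d > 0" "\<And>w. dist z w < d \<Longrightarrow> w \<in> R \<and> sdist (H z) (H w) < 2"
    using sph_holomorphic_on_continuous[OF H, of z 2] z V by auto
  obtain d' where d': "d' > 0" "ball z d' \<subseteq> V" using z V open_contains_ball by blast
  define B where "B = ball z (min d d')"
  have B: "B \<subseteq> V" "open B" "z \<in> B" "connected B" using d d' by (auto simp: B_def)
  have fin: "H w \<noteq> None" if "w \<in> B" for w
    using d(2)[of w] that Hz by (cases "H w") (auto simp: B_def)
  define h where "h = (\<lambda>w. the (H w))"
  have h: "h holomorphic_on B"
    unfolding h_def
    using B V by (intro holomorphic_on_the fin sph_holomorphic_on_subset[OF H]) auto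
  have FB: "F w = T (Some (h w))" if "w \<in> B" for w
    using fin[OF that] T(1) by (auto simp: h_def H_def rotation_pair_def)
  have "\<not> h constant_on B"
  proof
    assume "h constant_on B"
    then have "\<And>w. w \<in> B \<Longrightarrow> h w = h z" using B(3) unfolding constant_on_def by metis
    then have "\<And>w. w \<in> B \<Longrightarrow> F w = F z" using FB B(3) by metis
    moreover have "min d d' > 0" "ball z (min d d') \<subseteq> R"
      using d(1) d'(1) B(1) V(2) unfolding B_def by auto
    ultimately show False using nonconst unfolding B_def by blast
  qed
  then have "open (h ` B)"
    using open_mapping_thm[OF h B(2) B(4) B(2)] by blast
  then have "openin sph_top (T ` Some ` h ` B)"
    by (intro openin_rotation_image[OF T(1)] openin_sph_Some)
  moreover have "T ` Some ` h ` B = F ` B"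
    unfolding image_image by (intro image_cong refl) (simp add: FB)
  ultimately show "\<exists>U. openin sph_top U \<and> s \<in> U \<and> U \<subseteq> F ` V"
    using B z by (metis image_eqI image_mono)
qed

text \<open>A rotated affine chart centred at the given point reduces this to maps on the plane;
  finite fibres prevent the composite from being constant on any ball.\<close>

lemma openin_rational_image:
  assumes f: "sph_holomorphic_map f" and fin: "\<And>w. finite {z. f z = w}" and U: "openin sph_top U"
  shows "openin sph_top (f ` U)"
proof (subst openin_subopen, intro ballI)
  fix t assume "t \<in> f ` U"
  then obtain s where s: "t = f s" "s \<in> U" by blast
  obtain T T' where T: "rotation_pair T T'" "T (Some 0) = s" "T' s = Some 0"
    using rotation_pair_zero[of s] .
  define E where "E = T \<circ> Some"
  have E: "sph_holomorphic_on E UNIV"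
    using T(1) sph_holomorphic_on_Some[of "\<lambda>z. z" UNIV]
    by (simp add: E_def rotation_pair_def sph_holomorphic_map_def comp_def)
  have injE: "inj E"
    using T(1) unfolding E_def rotation_pair_def by (metis comp_apply injI option.inject)
  define V where "V = {z. E z \<in> U}"
  have V: "open V"
    using continuous_map_sph_holomorphic[OF E] U by (simp add: V_def continuous_map_def)
  have "sph_holomorphic_on (f \<circ> E) UNIV"
    using f E by (simp add: sph_holomorphic_map_def)
  then have "openin sph_top ((f \<circ> E) ` V)"
  proof (rule sph_open_mapping)
    fix z and r :: real assume r: "r > 0"
    show "\<exists>w\<in>ball z r. (f \<circ> E) w \<noteq> (f \<circ> E) z"
    proof (rule ccontr)
      assume "\<not> ?thesis"
      then have "E ` ball z r \<subseteq> {x. f x = f (E z)}" by auto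
      then have "finite (E ` ball z r)" using fin finite_subset by blast
      then have "finite (ball z r)" using injE by (metis finite_imageD inj_on_subset subset_UNIV)
      then show False using r uncountable_ball countable_finite by blast
    qed
  qed (use V in auto)
  moreover have "t \<in> (f \<circ> E) ` V" using s T by (auto simp: V_def E_def intro!: image_eqI[of _ _ 0])
  moreover have "(f \<circ> E) ` V \<subseteq> f ` U" by (auto simp: V_def)
  ultimately show "\<exists>W. openin sph_top W \<and> t \<in> W \<and> W \<subseteq> f ` U" by blast
qed

text \<open>Rotate p to infinity: the complement of a chordal ball around infinity is a closed
  Euclidean disc about 0, empty when \<open>e > 2\<close>.\<close>

lemma connectedin_sball_complement:
  assumes "e > 0"
  shows "connectedin sph_top {w. e \<le> sdist p w}"
proof -
  obtain T T' where T: "rotation_pair T T'" "T None = p" "T' p = None"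
    using rotation_pair_infinity[of p] .
  define D where "D = {z. e \<le> 2 / sqrt (1 + (cmod z)\<^sup>2)}"
  have "D = {z. (cmod z)\<^sup>2 \<le> (2/e)\<^sup>2 - 1}"
  proof -
    have "e \<le> 2 / sqrt (1 + (cmod z)\<^sup>2) \<longleftrightarrow> (cmod z)\<^sup>2 \<le> (2/e)\<^sup>2 - 1" for z
    proof -
      have "e \<le> 2 / sqrt (1 + (cmod z)\<^sup>2) \<longleftrightarrow> sqrt (1 + (cmod z)\<^sup>2) \<le> 2/e"
        using assms sum_squares_pos1[of z] by (simp add: field_simps)
      also have "\<dots> \<longleftrightarrow> 1 + (cmod z)\<^sup>2 \<le> (2/e)\<^sup>2"
        using assms real_sqrt_le_iff[of "1 + (cmod z)\<^sup>2" "(2/e)\<^sup>2"] by (simp add: real_sqrt_divide)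
      finally show ?thesis by auto
    qed
    then show ?thesis by (simp add: D_def)
  qed
  also have "\<dots> = cball 0 (sqrt ((2/e)\<^sup>2 - 1))"
  proof -
    have "(cmod z)\<^sup>2 \<le> r \<longleftrightarrow> cmod z \<le> sqrt r" for z r
      using real_sqrt_le_iff[of "(cmod z)\<^sup>2" r] by simp
    then show ?thesis by (auto simp del: real_sqrt_le_iff)
  qed
  finally have "connected D"
    by (simp add: convex_connected)
  then have "connectedin euclidean D" by simp
  moreover have "continuous_map euclidean sph_top (T \<circ> Some)"
    using T(1) sph_holomorphic_on_Some[of "\<lambda>z. z" UNIV] continuous_map_sph_holomorphic[of _ UNIV]
    by (simp add: rotation_pair_def sph_holomorphic_map_def comp_def)
  ultimately have "connectedin sph_top ((T \<circ> Some) ` D)"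
    by (rule connectedin_continuous_map_image[rotated])
  moreover have "(T \<circ> Some) ` D = {w. e \<le> sdist p w}"
  proof -
    have "sdist p w = sdist None (T' w)" for w
      using T unfolding rotation_pair_def by metis
    moreover have "e \<le> sdist None s \<longleftrightarrow> s \<in> Some ` D" for s
      using assms by (cases s) (auto simp: D_def)
    ultimately have "e \<le> sdist p w \<longleftrightarrow> T' w \<in> Some ` D" for w by simp
    moreover have "T' w \<in> X \<longleftrightarrow> w \<in> T ` X" for w X
      using T(1) unfolding rotation_pair_def by (metis imageE image_eqI)
    ultimately show ?thesis by (auto simp: image_comp)
  qed
  ultimately show ?thesis by simp
qed

text \<open>A rotation sends c to infinity, then z -> (z - \<alpha>) / (\<beta> - \<alpha>) sends
  the images of a and b to 0 and 1. The Lipschitz constant of the inverse brings estimates for maps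
  omitting 0, 1 and infinity back to the original sphere.\<close>

lemma three_point_normalization:
  assumes "a \<noteq> b" "a \<noteq> c" "b \<noteq> (c :: sphere)"
  obtains m m' L where "sph_holomorphic_map m" "m a = Some 0" "m b = Some 1" "m c = None"
    "\<And>s. m' (m s) = s" "L > 0" "\<And>s t. sdist (m' s) (m' t) \<le> L * sdist s t"
proof -
  obtain T T' where T: "rotation_pair T T'" "T None = c" "T' c = None"
    using rotation_pair_infinity[of c] .
  have inj: "T' s \<noteq> T' t" if "s \<noteq> t" for s t
    using that T(1) unfolding rotation_pair_def by metis
  obtain \<alpha> where \<alpha>: "T' a = Some \<alpha>" using inj[OF assms(2)] T by (cases "T' a") auto
  obtain \<beta> where \<beta>: "T' b = Some \<beta>" using inj[OF assms(3)] T by (cases "T' b") auto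
  have ne: "\<beta> - \<alpha> \<noteq> 0" using inj[OF assms(1)] \<alpha> \<beta> by auto
  have det: "1 * (\<beta> - \<alpha>) - (- \<alpha>) * 0 \<noteq> 0" and det': "(\<beta> - \<alpha>) * 1 - \<alpha> * 0 \<noteq> 0"
    using ne by auto
  define A where "A = mob 1 (- \<alpha>) 0 (\<beta> - \<alpha>)"
  define A' where "A' = mob (\<beta> - \<alpha>) \<alpha> 0 1"
  have A'A: "A' (A s) = s" for s
    using mob_inverse[OF det'] by (simp add: A_def A'_def)
  obtain L where L: "L > 0" "\<And>s t. sdist (A' s) (A' t) \<le> L * sdist s t"
    using hmap_Lipschitz[OF hgood_mob[OF det']] unfolding A'_def mob_def by metis
  show ?thesis
  proof (rule that[of "A \<circ> T'" "T \<circ> A'" L])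
    show "sph_holomorphic_map (A \<circ> T')"
      using T(1) sph_holomorphic_map_mob[OF det]
      by (simp add: A_def rotation_pair_def sph_holomorphic_map_comp)
    show "(A \<circ> T') a = Some 0"
      using mob_hpt[OF det, of \<alpha> 1] ne by (simp add: A_def \<alpha>) (simp add: hpt_def)
    show "(A \<circ> T') b = Some 1"
      using mob_hpt[OF det, of \<beta> 1] ne by (simp add: A_def \<beta>) (simp add: hpt_def)
    show "(A \<circ> T') c = None"
      using mob_hpt[OF det, of 1 0] by (simp add: A_def T)
    show "(T \<circ> A') ((A \<circ> T') s) = s" for s
      using T(1) by (simp add: A'A rotation_pair_def)
    show "sdist ((T \<circ> A') s) ((T \<circ> A') t) \<le> L * sdist s t" for s t
      using T(1) L by (simp add: rotation_pair_def)
  qed (fact L)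
qed

section \<open>Schottky's theorem in the chordal metric\<close>

lemma sdist_Some_le: "sdist (Some z) (Some w) \<le> 2 * cmod (z - w)"
proof -
  have "1 \<le> sqrt ((1 + (cmod z)\<^sup>2) * (1 + (cmod w)\<^sup>2))"
    by (simp add: mult_ge1_I)
  then have "2 * cmod (z - w) / sqrt ((1 + (cmod z)\<^sup>2) * (1 + (cmod w)\<^sup>2)) \<le> 2 * cmod (z - w) / 1"
    by (intro divide_left_mono) auto
  then show ?thesis by simp
qed

lemma sdist_inverse:
  assumes "z \<noteq> 0" "w \<noteq> 0"
  shows "sdist (Some (inverse z)) (Some (inverse w)) = sdist (Some z) (Some w)"
proof -
  have "hpt 1 z = Some (inverse z)" "hpt 1 w = Some (inverse w)" "hpt z 1 = Some z" "hpt w 1 = Some w"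
    using assms by (simp_all add: hpt_def divide_inverse)
  then show ?thesis
    using sdist_hpt[of 1 z 1 w] sdist_hpt[of z 1 w 1] by (simp add: add.commute norm_minus_commute real_sqrt_mult)
qed

text \<open>If the value at 0 has modulus at most 1, Schottky's theorem bounds h by an absolute
  constant and Cauchy's estimate bounds its derivative. Otherwise 1/h is used: it omits 0 and 1 as
  well, and inversion is a chordal isometry. Thus K does not depend on \<open>h 0\<close>.\<close>

lemma Schottky_chordal:
  "\<exists>K>0. \<forall>h r w. h holomorphic_on ball 0 r \<longrightarrow> (\<forall>z\<in>ball 0 r. h z \<noteq> 0 \<and> h z \<noteq> 1) \<longrightarrow>
     r > 0 \<longrightarrow> cmod w \<le> r / 8 \<longrightarrow> sdist (Some (h 0)) (Some (h w)) \<le> K * cmod w / r"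
proof -
  \<comment> \<open>Schottky's bound on the disc of radius 1/2 for functions with modulus at most 1
    at the origin.\<close>
  define B where "B = exp (pi * exp (pi * (2 + 2 * 1 + 12 * (1/2) / (1 - 1/2))))"
  have B: "B > 0" by (simp add: B_def)
  have core: "sdist (Some (h 0)) (Some (h w)) \<le> 16 * B * cmod w / r"
    if h: "h holomorphic_on ball 0 r" and omit: "\<And>z. z \<in> ball 0 r \<Longrightarrow> h z \<noteq> 0 \<and> h z \<noteq> 1"
      and r: "r > 0" and w: "cmod w \<le> r / 8" and h0: "cmod (h 0) \<le> 1" for h r w
  proof -
    have bd: "cmod (h z) \<le> B" if "cmod z \<le> r / 4" for z
    proof -
      \<comment> \<open>Scaling by r/2 rather than r gives a function holomorphic on the closed unit
        disc; the disc of radius 1/2 then corresponds to radius r/4.\<close>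
      define f where "f = (\<lambda>z. h (of_real (r/2) * z))"
      have sub: "of_real (r/2) * z \<in> ball 0 r" if "z \<in> cball 0 1" for z :: complex
      proof -
        have "cmod (of_real (r/2) * z) = r/2 * cmod z" using r by (simp add: norm_mult)
        also have "\<dots> \<le> r/2 * 1" using that r by (intro mult_left_mono) auto
        finally show ?thesis using r by simp
      qed
      have "(h \<circ> (\<lambda>z. of_real (r/2) * z)) holomorphic_on cball 0 1"
        by (rule holomorphic_on_compose_gen[OF _ h]) (use sub in \<open>auto intro!: holomorphic_intros\<close>)
      then have "f holomorphic_on cball 0 1" by (simp add: f_def comp_def)
      moreover have "cmod (f 0) \<le> 1" using h0 by (simp add: f_def)
      moreover have "\<not> (f z = 0 \<or> f z = 1)" if "z \<in> cball 0 1" for z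
        using omit[OF sub[OF that]] by (simp add: f_def)
      moreover have "cmod (z / of_real (r/2)) \<le> 1/2"
        using that r by (simp add: norm_divide field_simps)
      ultimately have "cmod (f (z / of_real (r/2))) \<le> B"
        unfolding B_def by (intro Schottky) auto
      then show ?thesis using r by (simp add: f_def)
    qed
    \<comment> \<open>Discs of radius r/8 about these points remain in the disc of radius r/4, where
      h is bounded by B.\<close>
    have der: "cmod (deriv h z) \<le> 8 * B / r" if z: "z \<in> cball 0 (r/8)" for z
    proof -
      have sub: "cball z (r/8) \<subseteq> cball 0 (r/4)"
      proof
        fix x assume "x \<in> cball z (r/8)"
        then show "x \<in> cball 0 (r/4)"
          using z norm_triangle_ineq[of "x - z" z] by (simp add: dist_norm norm_minus_commute)
      qed
      have sub2: "cball 0 (r/4) \<subseteq> ball 0 r" using r by auto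
      have hol: "h holomorphic_on cball z (r/8)"
        using h sub sub2 by (meson holomorphic_on_subset subset_trans)
      have "cmod ((deriv ^^ 1) h z) \<le> fact 1 * B / (r/8) ^ 1"
      proof (rule Cauchy_inequality)
        show "h holomorphic_on ball z (r/8)"
          using hol by (rule holomorphic_on_subset) auto
        show "continuous_on (cball z (r/8)) h"
          using hol by (rule holomorphic_on_imp_continuous_on)
        show "cmod (h x) \<le> B" if "cmod (z - x) = r/8" for x
        proof -
          have "x \<in> cball z (r/8)" using that by (simp add: dist_norm)
          then show ?thesis using sub bd by auto
        qed
      qed (use r in auto)
      then show ?thesis by (simp add: mult.commute)
    qed
    have "cmod (h w - h 0) \<le> 8 * B / r * cmod (w - 0)"
    proof (rule field_differentiable_bound)
      show "(h has_field_derivative deriv h z) (at z within cball 0 (r/8))" if "z \<in> cball 0 (r/8)" for z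
      proof -
        have "z \<in> ball 0 r" using that r by auto
        then show ?thesis using h
          by (meson has_field_derivative_at_within holomorphic_derivI open_ball)
      qed
    qed (use w r der in auto)
    then have "2 * cmod (h 0 - h w) \<le> 2 * (8 * B / r * cmod w)"
      by (simp add: norm_minus_commute)
    then show ?thesis
      using sdist_Some_le[of "h 0" "h w"] by simp
  qed
  show ?thesis
  proof (intro exI[of _ "16 * B"] conjI allI impI)
    fix h r w
    assume h: "h holomorphic_on ball 0 r" and omit: "\<forall>z\<in>ball 0 r. h z \<noteq> 0 \<and> h z \<noteq> 1"
      and r: "r > 0" and w: "cmod w \<le> r / 8"
    show "sdist (Some (h 0)) (Some (h w)) \<le> 16 * B * cmod w / r"
    proof (cases "cmod (h 0) \<le> 1")
      case True
      show ?thesis by (rule core[OF h _ r w True]) (use omit in blast)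
    next
      case False
      have "sdist (Some (inverse (h 0))) (Some (inverse (h w))) \<le> 16 * B * cmod w / r"
      proof (rule core)
        show "(\<lambda>z. inverse (h z)) holomorphic_on ball 0 r"
          using h omit by (intro holomorphic_intros) auto
        show "cmod (inverse (h 0)) \<le> 1"
          using False by (simp add: norm_inverse inverse_le_1_iff)
      qed (use omit r w in auto)
      moreover have "w \<in> ball 0 r" using r w by auto
      ultimately show ?thesis
        using sdist_inverse[of "h 0" "h w"] omit r by auto
    qed
  qed (use B in auto)
qed

text \<open>In the logarithmic coordinate, a point of the core circle is the centre of a disc of
  radius L, while the circle itself keeps the fixed length 2 pi.\<close>

lemma core_circle_small:
  assumes "a \<noteq> b" "a \<noteq> c" "b \<noteq> (c :: sphere)"
  shows "\<exists>K>0. \<forall>F \<rho> L z. sph_holomorphic_on F {z. \<rho> * exp (- L) < cmod z \<and> cmod z < \<rho> * exp L} \<longrightarrow>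
       (\<forall>z. \<rho> * exp (- L) < cmod z \<and> cmod z < \<rho> * exp L \<longrightarrow> F z \<noteq> a \<and> F z \<noteq> b \<and> F z \<noteq> c) \<longrightarrow>
       \<rho> > 0 \<longrightarrow> L \<ge> 8 * pi \<longrightarrow> cmod z = \<rho> \<longrightarrow> sdist (F (of_real \<rho>)) (F z) \<le> K / L"
proof -
  obtain m m' M where m: "sph_holomorphic_map m" "m a = Some 0" "m b = Some 1" "m c = None"
    and m': "\<And>s. m' (m s) = s" and M: "M > 0" "\<And>s t. sdist (m' s) (m' t) \<le> M * sdist s t"
    using three_point_normalization[OF assms] by metis
  obtain K where K: "K > 0"
    "\<And>h r w. h holomorphic_on ball 0 r \<Longrightarrow> \<forall>z\<in>ball 0 r. h z \<noteq> 0 \<and> h z \<noteq> 1 \<Longrightarrow>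
       r > 0 \<Longrightarrow> cmod w \<le> r / 8 \<Longrightarrow> sdist (Some (h 0)) (Some (h w)) \<le> K * cmod w / r"
    using Schottky_chordal by blast
  show ?thesis
  \<comment> \<open>M undoes the normalization of a, b, c, K is the Schottky constant, and pi bounds
    the distance in the logarithmic coordinate.\<close>
  proof (intro exI[of _ "M * K * pi"] conjI allI impI)
    show "M * K * pi > 0" using M K by simp
    fix F \<rho> L z
    assume F: "sph_holomorphic_on F {z. \<rho> * exp (- L) < cmod z \<and> cmod z < \<rho> * exp L}"
      and omit: "\<forall>z. \<rho> * exp (- L) < cmod z \<and> cmod z < \<rho> * exp L \<longrightarrow> F z \<noteq> a \<and> F z \<noteq> b \<and> F z \<noteq> c"
      and \<rho>: "\<rho> > 0" and L: "L \<ge> 8 * pi" and z: "cmod z = \<rho>"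
    have L0: "L > 0" using L pi_gt_zero by linarith
    \<comment> \<open>The modulus of \<open>k \<zeta>\<close> is
      \<open>\<rho> * exp (Re \<zeta>)\<close>, so the disc of radius L lands in the
      annulus.\<close>
    define k where "k = (\<lambda>\<zeta>::complex. of_real \<rho> * exp \<zeta>)"
    have k: "\<rho> * exp (- L) < cmod (k \<zeta>)" "cmod (k \<zeta>) < \<rho> * exp L" if "\<zeta> \<in> ball 0 L" for \<zeta>
      using that abs_Re_le_cmod[of \<zeta>] \<rho> by (auto simp: k_def norm_mult)
    define H where "H = m \<circ> (F \<circ> k)"
    have "sph_holomorphic_on (F \<circ> k) (ball 0 L)"
      by (rule sph_holomorphic_on_compose[OF F]) (use k in \<open>auto simp: k_def intro!: holomorphic_intros\<close>)
    then have H: "sph_holomorphic_on H (ball 0 L)"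
      using m(1) by (simp add: H_def sph_holomorphic_map_def)
    have Hom: "H \<zeta> \<noteq> Some 0 \<and> H \<zeta> \<noteq> Some 1 \<and> H \<zeta> \<noteq> None" if "\<zeta> \<in> ball 0 L" for \<zeta>
      using omit k[OF that] m m' unfolding H_def by (metis comp_apply)
    define h where "h = (\<lambda>\<zeta>. the (H \<zeta>))"
    have Hh: "H \<zeta> = Some (h \<zeta>)" if "\<zeta> \<in> ball 0 L" for \<zeta>
      using Hom[OF that] by (auto simp: h_def)
    \<comment> \<open>A logarithm of \<open>z / \<rho>\<close> of modulus at most pi; the assumption
      \<open>L \<ge> 8 * pi\<close> puts it within L/8 of the centre.\<close>
    define w where "w = \<i> * of_real (Arg z)"
    have w: "cmod w \<le> pi" using Arg_bounded[of z] by (auto simp: w_def norm_mult)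
    have wL: "w \<in> ball 0 L" "(0::complex) \<in> ball 0 L" "cmod w \<le> L / 8"
      using w L L0 pi_gt_zero unfolding mem_ball_0 norm_zero by linarith+
    have hol: "h holomorphic_on ball 0 L"
      unfolding h_def using Hom by (intro holomorphic_on_the H) auto
    have om: "\<forall>z\<in>ball 0 L. h z \<noteq> 0 \<and> h z \<noteq> 1"
    proof
      fix \<zeta> :: complex assume "\<zeta> \<in> ball 0 L"
      then show "h \<zeta> \<noteq> 0 \<and> h \<zeta> \<noteq> 1" using Hom[of \<zeta>] Hh[of \<zeta>] by auto
    qed
    have "sdist (Some (h 0)) (Some (h w)) \<le> K * cmod w / L"
      by (rule K(2)[OF hol om L0 wL(3)])
    also have "\<dots> \<le> K * pi / L"
      using w K(1) L0 by (intro divide_right_mono mult_left_mono) auto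
    finally have "sdist (H 0) (H w) \<le> K * pi / L"
      using Hh wL by simp
    then have "M * sdist (H 0) (H w) \<le> M * (K * pi / L)" using M(1) by (intro mult_left_mono) auto
    moreover have "k 0 = of_real \<rho>" by (simp add: k_def)
    moreover have "k w = z"
      using z \<rho> Arg_eq[of z] by (auto simp: k_def w_def)
    ultimately show "sdist (F (of_real \<rho>)) (F z) \<le> M * K * pi / L"
      using M(2)[of "H 0" "H w"] m' by (simp add: H_def)
  qed
qed

subsection \<open>Separation by the core circle of an annulus\<close>

lemma connected_norm_in_interval:
  assumes "is_interval J" "J \<subseteq> {0<..}"
  shows "connected {z :: complex. cmod z \<in> J}"
proof -
  have "connected (J \<times> sphere (0::complex) 1)"
    using assms by (intro connected_Times connected_sphere) (auto simp: is_interval_connected)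
  moreover have "continuous_on (J \<times> sphere (0::complex) 1) (\<lambda>x. of_real (fst x) * snd x)"
    by (intro continuous_intros)
  ultimately have "connected ((\<lambda>x. of_real (fst x) * snd x) ` (J \<times> sphere (0::complex) 1))"
    by (rule connected_continuous_image[rotated])
  moreover have "(\<lambda>x. of_real (fst x) * snd x) ` (J \<times> sphere (0::complex) 1) = {z. cmod z \<in> J}"
  proof (intro equalityI subsetI)
    fix z :: complex assume z: "z \<in> {z. cmod z \<in> J}"
    then have "z \<noteq> 0" using assms by auto
    then have "z = of_real (fst (cmod z, sgn z)) * snd (cmod z, sgn z)"
      by (simp add: sgn_div_norm scaleR_conv_of_real)
    moreover have "norm (sgn z) = 1" using \<open>z \<noteq> 0\<close> by (simp add: norm_sgn)
    ultimately show "z \<in> (\<lambda>x. of_real (fst x) * snd x) ` (J \<times> sphere (0::complex) 1)"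
      using z by (intro image_eqI[of _ _ "(cmod z, sgn z)"]) auto
  qed (use assms in \<open>auto simp: norm_mult subset_iff\<close>)
  ultimately show ?thesis by simp
qed

lemma open_round_annulus: "open (round_annulus r1 r2)"
  unfolding round_annulus_def by (intro open_Collect_conj open_Collect_less continuous_intros)

text \<open>If the complement of an annulus splits into two closed pieces, each of the two ends of the
  annulus accumulates on exactly one piece; hence already the core circle separates the pieces.\<close>

lemma core_circle_separates:
  assumes r1: "0 \<le> r1" and \<phi>: "sph_holomorphic_on \<phi> (round_annulus r1 r2)"
    and inj: "inj_on \<phi> (round_annulus r1 r2)"
    and xy: "x \<notin> \<phi> ` round_annulus r1 r2" "y \<notin> \<phi> ` round_annulus r1 r2"
    and sep: "\<not> connected_component_of (subtopology sph_top (UNIV - \<phi> ` round_annulus r1 r2)) x y"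
    and \<rho>: "r1 < ereal \<rho>" "ereal \<rho> < r2"
  obtains W1 W2 where "openin sph_top W1" "openin sph_top W2" "W1 \<inter> W2 = {}" "x \<in> W1" "y \<in> W2"
    "W1 \<union> W2 = UNIV - \<phi> ` {z. cmod z = \<rho>}"
proof -
  define R where "R = round_annulus r1 r2"
  have R: "z \<in> R \<longleftrightarrow> r1 < ereal (cmod z) \<and> ereal (cmod z) < r2" for z
    by (simp add: R_def round_annulus_def)
  have mono1: "r1 < ereal t" if "r1 < ereal s" "s \<le> t" for s t
    using that by (meson ereal_less_eq(3) less_le_trans)
  have mono2: "ereal s < r2" if "ereal t < r2" "s \<le> t" for s t
    using that by (meson ereal_less_eq(3) le_less_trans)
  have \<rho>0: "\<rho> > 0" using \<rho>(1) r1 by (metis ereal_less(2) order_le_less_trans)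
  have cont: "continuous_map (top_of_set R) sph_top \<phi>"
    using continuous_map_sph_holomorphic \<phi> by (simp add: R_def)
  have openim: "openin sph_top (\<phi> ` V)" if "open V" "V \<subseteq> R" for V
  proof (rule sph_open_mapping)
    show "\<exists>w\<in>ball z r. \<phi> w \<noteq> \<phi> z" if "r > 0" "ball z r \<subseteq> R" for z and r :: real
    proof -
      have "ball z r \<noteq> {z}"
        using that(1) uncountable_ball by (metis countable_finite finite.emptyI finite_insert)
      moreover have "z \<in> ball z r" using \<open>r > 0\<close> by simp
      ultimately obtain w where "w \<in> ball z r" "w \<noteq> z" by blast
      then show ?thesis using inj that by (metis R_def centre_in_ball inj_onD subsetD)
    qed
  qed (use \<phi> that R_def in auto)
  define A where "A = \<phi> ` R"
  define E where "E = UNIV - A"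
  have Aop: "openin sph_top A" using openim[of R] open_round_annulus by (simp add: A_def R_def)
  have Ecl: "closedin sph_top E" using Aop by (simp add: E_def closedin_def Diff_Diff_Int)
  have Ecomp: "compact_space (subtopology sph_top E)"
    by (intro compact_space_subtopology closedin_compact_space compact_sph Ecl)
  \<comment> \<open>In a compact Hausdorff space components and quasi-components agree, so x and y
    are separated by a clopen subset of E.\<close>
  have "\<not> quasi_component_of (subtopology sph_top E) x y"
    using sep quasi_eq_connected_component_of[of "subtopology sph_top E" x] Ecomp
      Hausdorff_space_subtopology[OF Hausdorff_sph]
    by (simp add: E_def A_def R_def)
  moreover have xyE: "x \<in> E" "y \<in> E" using xy by (simp_all add: E_def A_def R_def)
  ultimately obtain T where T: "closedin (subtopology sph_top E) T" "openin (subtopology sph_top E) T"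
    "(x \<in> T) \<noteq> (y \<in> T)"
    unfolding quasi_component_of_def by auto
  define P where "P = (if x \<in> T then T else E - T)"
  define Q where "Q = E - P"
  have P: "closedin (subtopology sph_top E) P" "openin (subtopology sph_top E) P"
    using T openin_diff[OF openin_topspace T(1)] closedin_diff[OF closedin_topspace T(2)]
    by (simp_all add: P_def)
  then have "closedin (subtopology sph_top E) Q"
    by (simp add: Q_def closedin_diff)
  then have PQ: "closedin sph_top P" "closedin sph_top Q"
    using P Ecl by (simp_all add: closedin_closed_subtopology)
  have PQE: "P \<union> Q = E" "P \<inter> Q = {}" "x \<in> P" "y \<in> Q"
    using T xyE P(1) closedin_subset[OF P(1)] by (auto simp: P_def Q_def)
  obtain U V where UV: "openin sph_top U" "openin sph_top V" "P \<subseteq> U" "Q \<subseteq> V" "U \<inter> V = {}"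
    using normal_sph PQ PQE(2) unfolding normal_space_def disjnt_def by meson
  \<comment> \<open>The part of the annulus left uncovered by the neighbourhoods of the two pieces.
    Its image is closed in the sphere, so it is compact and stays away from both ends of the
    annulus.\<close>
  define C where "C = {z \<in> R. \<phi> z \<notin> U \<union> V}"
  have "compact C"
  proof -
    have "homeomorphic_map (top_of_set R) (subtopology sph_top A) \<phi>"
    proof (rule bijective_open_imp_homeomorphic_map)
      show "continuous_map (top_of_set R) (subtopology sph_top A) \<phi>"
        using cont by (simp add: continuous_map_in_subtopology A_def)
      have "openin sph_top (\<phi> ` V)" if "openin (top_of_set R) V" for V
        using that openim open_round_annulus[of r1 r2]
        by (metis R_def openin_open_eq)
      then show "open_map (top_of_set R) (subtopology sph_top A) \<phi>"
        using Aop by (auto simp: open_map_def openin_open_subtopology A_def dest: openin_imp_subset)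
    qed (use inj in \<open>auto simp: A_def R_def\<close>)
    moreover have "\<phi> ` C = UNIV - (U \<union> V)"
      using UV PQE unfolding C_def E_def A_def by auto
    moreover have "closedin sph_top (UNIV - (U \<union> V))"
      using closedin_diff[OF closedin_topspace openin_Un[OF UV(1,2)]] by simp
    ultimately have "compactin (top_of_set R) C"
      using homeomorphic_map_compactness[of "top_of_set R" "subtopology sph_top A" \<phi> C]
      by (auto simp: C_def A_def compactin_subtopology compact_sph closedin_compact_space)
    then show ?thesis by (simp add: compactin_subtopology)
  qed
  \<comment> \<open>Adding \<rho> makes the set nonempty and ensures
    \<open>s1 \<le> \<rho> \<le> s2\<close>.\<close>
  then have comp: "compact (insert (of_real \<rho>) C)" by (rule compact_insert)
  have \<rho>R: "of_real \<rho> \<in> R" using \<rho> \<rho>0 by (simp add: R)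
  then have CR: "insert (of_real \<rho>) C \<subseteq> R" by (auto simp: C_def)
  obtain z1 where z1: "z1 \<in> insert (of_real \<rho>) C" "\<forall>z\<in>insert (of_real \<rho>) C. cmod z1 \<le> cmod z"
    using continuous_attains_inf[OF comp, of cmod] continuous_on_norm_id by blast
  obtain z2 where z2: "z2 \<in> insert (of_real \<rho>) C" "\<forall>z\<in>insert (of_real \<rho>) C. cmod z \<le> cmod z2"
    using continuous_attains_sup[OF comp, of cmod] continuous_on_norm_id by blast
  define s1 s2 where "s1 = cmod z1" and "s2 = cmod z2"
  have s: "s1 \<le> \<rho>" "\<rho> \<le> s2" using z1(2) z2(2) \<rho>0 by (auto simp: s1_def s2_def)
  have sR: "r1 < ereal s1" "ereal s2 < r2" using z1(1) z2(1) CR R by (auto simp: s1_def s2_def)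
  define In Mid Out where "In = \<phi> ` {z \<in> R. cmod z < s1}"
    and "Mid = \<phi> ` {z. s1 \<le> cmod z \<and> cmod z \<le> s2}" and "Out = \<phi> ` {z \<in> R. cmod z > s2}"
  have midR: "{z. s1 \<le> cmod z \<and> cmod z \<le> s2} \<subseteq> R"
    using mono1[OF sR(1)] mono2[OF sR(2)] by (auto simp: R)
  have Mid_cl: "closedin sph_top Mid"
  proof -
    have "{z. s1 \<le> cmod z \<and> cmod z \<le> s2} = cball 0 s2 - ball 0 s1" by auto
    then have "compact {z. s1 \<le> cmod z \<and> cmod z \<le> s2}" by (simp add: compact_diff)
    then have "compactin (top_of_set R) {z. s1 \<le> cmod z \<and> cmod z \<le> s2}"
      using midR by (simp add: compactin_subtopology)
    then show ?thesis
      unfolding Mid_def using cont by (intro compactin_imp_closedin Hausdorff_sph image_compactin)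
  qed
  have Mid_E: "Mid \<inter> E = {}" using midR by (auto simp: Mid_def E_def A_def)
  \<comment> \<open>A connected family of circles that avoids C lies entirely in one of the two
    disjoint neighbourhoods.\<close>
  have collar: "\<phi> ` X \<subseteq> U \<or> \<phi> ` X \<subseteq> V"
    if X: "X = {z. cmod z \<in> J}" "is_interval J" "X \<subseteq> R" "X \<inter> C = {}" "J \<subseteq> {0<..}" for X J
  proof -
    have "connected X" using X connected_norm_in_interval by simp
    then have "connectedin (top_of_set R) X" using X by (simp add: connectedin_subtopology)
    then have con: "connectedin sph_top (\<phi> ` X)" using cont by (rule connectedin_continuous_map_image[rotated])
    have "\<phi> ` X \<subseteq> U \<union> V" using X by (auto simp: C_def)
    then show ?thesis using connectedinD[OF con UV(1,2)] UV(5) by blast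
  qed
  have pos: "t > 0" if "r1 < ereal t" for t
    using that r1 by (metis ereal_less(2) order_le_less_trans)
  have In: "In \<subseteq> U \<or> In \<subseteq> V"
    unfolding In_def
  proof (rule collar)
    show "{z \<in> R. cmod z < s1} = {z. cmod z \<in> {t. r1 < ereal t \<and> t < s1}}"
      using s mono2[OF \<rho>(2)] by (auto simp: R)
    show "is_interval {t. r1 < ereal t \<and> t < s1}"
      unfolding is_interval_1 by (auto intro: mono1)
    show "{z \<in> R. cmod z < s1} \<inter> C = {}" using z1(2) by (auto simp: s1_def)
  qed (auto simp: pos)
  have Out: "Out \<subseteq> U \<or> Out \<subseteq> V"
    unfolding Out_def
  proof (rule collar)
    show "{z \<in> R. cmod z > s2} = {z. cmod z \<in> {t. s2 < t \<and> ereal t < r2}}"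
      using s mono1[OF \<rho>(1)] by (auto simp: R)
    show "is_interval {t. s2 < t \<and> ereal t < r2}"
      unfolding is_interval_1 by (auto intro: mono2)
    show "{z \<in> R. cmod z > s2} \<inter> C = {}" using z2(2) by (auto simp: s2_def)
  qed (use s \<rho>0 in auto)
  have AIO: "A = In \<union> Mid \<union> Out"
  proof -
    have "R = {z \<in> R. cmod z < s1} \<union> {z. s1 \<le> cmod z \<and> cmod z \<le> s2} \<union> {z \<in> R. cmod z > s2}"
      using midR by auto
    from arg_cong[OF this, of "image \<phi>"] show ?thesis
      unfolding A_def In_def Mid_def Out_def image_Un .
  qed
  define L G where "L = {z \<in> R. cmod z < \<rho>}" and "G = {z \<in> R. cmod z > \<rho>}"
  have LG: "open L" "open G"
    unfolding L_def G_def R_def Collect_conj_eq Collect_mem_eq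
    by (intro open_Int open_round_annulus open_Collect_less continuous_intros)+
  have noclopen: False if "openin sph_top S" "closedin sph_top S" "S \<noteq> {}" "S \<noteq> UNIV" for S
    using connected_sph that unfolding connected_space_clopen_in by auto
  \<comment> \<open>When the ends lie on different sides, \<open>Mid\<close> is removed from both
    neighbourhoods and the annulus is cut along the core circle instead: its inner half is added to
    one side, its outer half to the other.\<close>
  have key: "\<exists>W1 W2. openin sph_top W1 \<and> openin sph_top W2 \<and> W1 \<inter> W2 = {} \<and>
      W1 \<union> W2 = UNIV - \<phi> ` {z. cmod z = \<rho>} \<and> U' - Mid \<subseteq> W1 \<and> V' - Mid \<subseteq> W2"
    if U': "openin sph_top U'" "openin sph_top V'" "U' \<inter> V' = {}" "E \<subseteq> U' \<union> V'" "In \<subseteq> U'" "Out \<subseteq> V'"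
    for U' V'
  proof (intro exI conjI)
    show "openin sph_top ((U' - Mid) \<union> \<phi> ` L)" "openin sph_top ((V' - Mid) \<union> \<phi> ` G)"
      using U' Mid_cl LG by (auto simp: L_def G_def intro!: openin_Un openin_diff openim)
    have cR: "{z. cmod z = \<rho>} \<subseteq> R" using \<rho> by (auto simp: R)
    have inj': "inj_on \<phi> R" using inj by (simp add: R_def)
    have Lsub: "\<phi> ` L \<subseteq> In \<union> Mid" and Gsub: "\<phi> ` G \<subseteq> Mid \<union> Out"
    proof -
      have "L \<subseteq> {z \<in> R. cmod z < s1} \<union> {z. s1 \<le> cmod z \<and> cmod z \<le> s2}"
        "G \<subseteq> {z. s1 \<le> cmod z \<and> cmod z \<le> s2} \<union> {z \<in> R. cmod z > s2}"
        using s by (auto simp: L_def G_def)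
      then show "\<phi> ` L \<subseteq> In \<union> Mid" "\<phi> ` G \<subseteq> Mid \<union> Out"
        unfolding In_def Mid_def Out_def by blast+
    qed
    have csub: "\<phi> ` {z. cmod z = \<rho>} \<subseteq> Mid" using s by (auto simp: Mid_def)
    have dis: "\<phi> ` L \<inter> \<phi> ` G = {}" "\<phi> ` L \<inter> \<phi> ` {z. cmod z = \<rho>} = {}" "\<phi> ` G \<inter> \<phi> ` {z. cmod z = \<rho>} = {}"
      using inj_on_image_Int[OF inj', of L G] inj_on_image_Int[OF inj' _ cR, of L]
        inj_on_image_Int[OF inj' _ cR, of G]
      by (auto simp: L_def G_def)
    have ALG: "A = \<phi> ` L \<union> \<phi> ` G \<union> \<phi> ` {z. cmod z = \<rho>}"
    proof -
      have "R = L \<union> G \<union> {z. cmod z = \<rho>}"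
        using cR by (auto simp: L_def G_def)
      from arg_cong[OF this, of "image \<phi>"] show ?thesis
        unfolding A_def image_Un .
    qed
    show "((U' - Mid) \<union> \<phi> ` L) \<inter> ((V' - Mid) \<union> \<phi> ` G) = {}"
      using U' Lsub Gsub dis by blast
    show "((U' - Mid) \<union> \<phi> ` L) \<union> ((V' - Mid) \<union> \<phi> ` G) = UNIV - \<phi> ` {z. cmod z = \<rho>}"
      using U' csub dis ALG Mid_E unfolding E_def by blast
  qed auto
  have xyM: "x \<in> U - Mid" "y \<in> V - Mid" using PQE UV Mid_E xyE by auto
  have EUV: "E \<subseteq> U \<union> V" using PQE UV by auto
  consider "In \<subseteq> U" "Out \<subseteq> V" | "In \<subseteq> V" "Out \<subseteq> U" | "In \<subseteq> U" "Out \<subseteq> U" | "In \<subseteq> V" "Out \<subseteq> V"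
    using In Out by blast
  then show ?thesis
  proof cases
    case 1
    from key[OF UV(1,2,5) EUV 1] obtain W1 W2 where W: "openin sph_top W1" "openin sph_top W2"
      "W1 \<inter> W2 = {}" "W1 \<union> W2 = UNIV - \<phi> ` {z. cmod z = \<rho>}" "U - Mid \<subseteq> W1" "V - Mid \<subseteq> W2"
      by (elim exE conjE)
    show ?thesis by (rule that[OF W(1-3) _ _ W(4)]) (use W xyM in auto)
  next
    case 2
    have "V \<inter> U = {}" "E \<subseteq> V \<union> U" using UV(5) EUV by auto
    from key[OF UV(2,1) this 2] obtain W1 W2 where W: "openin sph_top W1" "openin sph_top W2"
      "W1 \<inter> W2 = {}" "W1 \<union> W2 = UNIV - \<phi> ` {z. cmod z = \<rho>}" "V - Mid \<subseteq> W1" "U - Mid \<subseteq> W2"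
      by (elim exE conjE)
    show ?thesis by (rule that[OF W(2,1)]) (use W xyM in auto)
  next
    case 3
    \<comment> \<open>If both ends lie in U, then V meets the annulus only in \<open>Mid\<close>; so
      Q is open as well as closed, against the connectedness of the sphere.\<close>
    have "V - Mid = Q" using 3 UV(3-5) PQE(1,2) AIO Mid_E unfolding E_def by blast
    then have "openin sph_top Q" using openin_diff[OF UV(2) Mid_cl] by simp
    moreover have "Q \<noteq> {}" "Q \<noteq> UNIV" using PQE by auto
    ultimately show ?thesis using noclopen[of Q] PQ(2) by simp
  next
    case 4
    have "U - Mid = P" using 4 UV(3-5) PQE(1,2) AIO Mid_E unfolding E_def by blast
    then have "openin sph_top P" using openin_diff[OF UV(1) Mid_cl] by simp
    moreover have "P \<noteq> {}" "P \<noteq> UNIV" using PQE by auto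
    ultimately show ?thesis using noclopen[of P] PQ(1) by simp
  qed
qed

subsection \<open>Normality\<close>

lemma openin_fatou: "openin sph_top (fatou_set G)"
  unfolding fatou_set_def by (subst openin_subopen) auto

lemma compactin_julia: "compactin sph_top (julia_set G)"
proof -
  have "closedin sph_top (julia_set G)"
    using closedin_diff[OF closedin_topspace openin_fatou[of G]] by (simp add: julia_set_def)
  then show ?thesis by (rule closedin_compact_space[OF compact_sph])
qed

text \<open>Normality of the maps \<open>h \<circ> f\<close> near z descends to normality of the
  maps h on the image of that neighbourhood, which is open.\<close>

lemma fatou_forward_invariant:
  assumes f: "f \<in> G" and closed: "\<And>h. h \<in> G \<Longrightarrow> h \<circ> f \<in> G"
    and openim: "\<And>U. openin sph_top U \<Longrightarrow> openin sph_top (f ` U)"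
    and z: "z \<in> fatou_set G"
  shows "f z \<in> fatou_set G"
proof -
  obtain U where U: "openin sph_top U" "z \<in> U" "normal_on G U"
    using z unfolding fatou_set_def by blast
  have "normal_on G (f ` U)"
    unfolding normal_on_def
  proof (intro allI impI)
    fix h :: "nat \<Rightarrow> sphere \<Rightarrow> sphere" assume h: "\<forall>n. h n \<in> G"
    then have "\<forall>n. h n \<circ> f \<in> G" using closed by blast
    then obtain r \<psi> where r: "strict_mono (r :: nat \<Rightarrow> nat)" and
      conv: "\<And>z. z \<in> U \<Longrightarrow> \<exists>V. openin sph_top V \<and> z \<in> V \<and> V \<subseteq> U \<and>
              (\<forall>e>0. \<exists>N. \<forall>n\<ge>N. \<forall>w\<in>V. sdist ((h (r n) \<circ> f) w) (\<psi> w) < e)"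
      using U(3)[unfolded normal_on_def, rule_format, of "\<lambda>n. h n \<circ> f"] by blast
    \<comment> \<open>Choosing a preimage is harmless: the limit of \<open>h (r n) (f v)\<close>
      depends on \<open>f v\<close> alone, so \<psi> is constant on the fibres of f in U.\<close>
    define \<psi>' where "\<psi>' w = \<psi> (SOME v. v \<in> U \<and> f v = w)" for w
    have \<psi>': "\<psi>' (f v) = \<psi> v" if v: "v \<in> U" for v
    proof -
      define v0 where "v0 = (SOME v'. v' \<in> U \<and> f v' = f v)"
      have "v0 \<in> U \<and> f v0 = f v" unfolding v0_def by (rule someI[of _ v]) (use v in auto)
      then have v0: "v0 \<in> U" "f v0 = f v" by auto
      have lim: "\<exists>N. \<forall>n\<ge>N. sdist (h (r n) (f u)) (\<psi> u) < e" if "u \<in> U" "e > 0" for u e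
        using conv[OF that(1)] that(2) by (metis comp_apply)
      have "sdist (\<psi> v0) (\<psi> v) < e" if e: "e > 0" for e
      proof -
        from e have e2: "e/2 > 0" by simp
        obtain N1 where N1: "\<forall>n\<ge>N1. sdist (h (r n) (f v)) (\<psi> v0) < e/2"
          using lim[OF v0(1) e2] unfolding v0(2) by blast
        obtain N2 where N2: "\<forall>n\<ge>N2. sdist (h (r n) (f v)) (\<psi> v) < e/2"
          using lim[OF v e2] by blast
        define x where "x = h (r (max N1 N2)) (f v)"
        have "sdist x (\<psi> v0) < e/2" "sdist x (\<psi> v) < e/2"
          using N1 N2 by (auto simp: x_def)
        then show ?thesis
          using sph.triangle[of "\<psi> v0" x "\<psi> v"] sph.commute[of "\<psi> v0" x] by simp
      qed
      then have "sdist (\<psi> v0) (\<psi> v) = 0"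
        using sph.nonneg[of "\<psi> v0" "\<psi> v"] by (metis less_irrefl order_le_less)
      then show ?thesis by (simp add: \<psi>'_def flip: v0_def)
    qed
    have "\<exists>V. openin sph_top V \<and> y \<in> V \<and> V \<subseteq> f ` U \<and>
            (\<forall>e>0. \<exists>N. \<forall>n\<ge>N. \<forall>w\<in>V. sdist (h (r n) w) (\<psi>' w) < e)" if y: "y \<in> f ` U" for y
    proof -
      obtain v where v: "v \<in> U" "y = f v" using y by blast
      obtain V where V: "openin sph_top V" "v \<in> V" "V \<subseteq> U"
        "\<And>e. e > 0 \<Longrightarrow> \<exists>N. \<forall>n\<ge>N. \<forall>w\<in>V. sdist ((h (r n) \<circ> f) w) (\<psi> w) < e"
        using conv[OF v(1)] by blast
      show ?thesis
      proof (intro exI[of _ "f ` V"] conjI allI impI)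
        show "openin sph_top (f ` V)" using openim V by blast
        fix e :: real assume "e > 0"
        then obtain N where N: "\<forall>n\<ge>N. \<forall>w\<in>V. sdist ((h (r n) \<circ> f) w) (\<psi> w) < e"
          using V(4) by blast
        have "\<forall>n\<ge>N. \<forall>w\<in>f ` V. sdist (h (r n) w) (\<psi>' w) < e"
        proof (intro allI impI ballI)
          fix n w assume "n \<ge> N" "w \<in> f ` V"
          then obtain u where u: "u \<in> V" "w = f u" by blast
          then show "sdist (h (r n) w) (\<psi>' w) < e"
            using N \<open>n \<ge> N\<close> \<psi>'[of u] V(3) by auto
        qed
        then show "\<exists>N. \<forall>n\<ge>N. \<forall>w\<in>f ` V. sdist (h (r n) w) (\<psi>' w) < e" by blast
      qed (use V v in auto)
    qed
    then show "\<exists>(r :: nat \<Rightarrow> nat) \<phi>. strict_mono r \<and> (\<forall>z\<in>f ` U. \<exists>V. openin sph_top V \<and> z \<in> V \<and> V \<subseteq> f ` U \<and>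
              (\<forall>e>0. \<exists>N. \<forall>n\<ge>N. \<forall>w\<in>V. sdist (h (r n) w) (\<phi> w) < e))"
      using r by blast
  qed
  then show ?thesis
    using U openim unfolding fatou_set_def by blast
qed

lemma sdist_zero_less_1:
  assumes "sdist (Some 0) s < 1"
  obtains z where "s = Some z" "cmod z \<le> 1"
proof (cases s)
  case None
  then show ?thesis using assms by simp
next
  case (Some z)
  have "cmod z \<le> 1"
  proof (rule ccontr)
    assume "\<not> cmod z \<le> 1"
    then have "1 \<le> (cmod z)\<^sup>2" by (simp add: power2_eq_square mult_ge1_I)
    then have "sqrt (1 + (cmod z)\<^sup>2) \<le> 2 * cmod z"
      by (intro real_le_lsqrt) (simp_all add: power_mult_distrib)
    moreover have "2 * cmod z / sqrt (1 + (cmod z)\<^sup>2) < 1" using assms Some by simp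
    ultimately show False using sum_squares_pos1[of z] by (simp add: divide_less_eq)
  qed
  then show ?thesis using that Some by blast
qed

text \<open>By compactness some subsequence of the values at x converges to a point p. Eventually
  all images of W lie within 1/2 + 1/2 of p; with p rotated to 0 they lie in the closed unit disc,
  where Montel's theorem for bounded families applies.\<close>

lemma normal_of_small_images:
  assumes hol: "\<And>f. f \<in> G \<Longrightarrow> sph_holomorphic_map f"
    and W: "openin sph_top W" "x \<in> W"
    and small: "\<And>f w. f \<in> G \<Longrightarrow> w \<in> W \<Longrightarrow> sdist (f x) (f w) < 1/2"
  shows "x \<in> fatou_set G"
proof -
  obtain T T' where T: "rotation_pair T T'" "T (Some 0) = x" "T' x = Some 0"
    using rotation_pair_zero[of x] .
  have TT': "T' (T s) = s" for s using T(1) by (simp add: rotation_pair_def)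
  define E where "E = T \<circ> Some"
  have E: "sph_holomorphic_on E UNIV"
    using T(1) sph_holomorphic_on_Some[of "\<lambda>z. z" UNIV]
    by (simp add: E_def rotation_pair_def sph_holomorphic_map_def comp_def)
  have "open {z. E z \<in> W}"
    using continuous_map_sph_holomorphic[OF E] W by (simp add: continuous_map_def)
  moreover have "0 \<in> {z. E z \<in> W}" using W T by (simp add: E_def)
  ultimately obtain d where d: "d > 0" "ball 0 d \<subseteq> {z. E z \<in> W}"
    using open_contains_ball by blast
  \<comment> \<open>Half the radius: Montel gives uniform convergence on compact sets, hence on all
    of U at once.\<close>
  define U where "U = E ` ball 0 (d/2)"
  have U: "openin sph_top U"
    unfolding U_def E_def image_comp[symmetric]
    by (intro openin_rotation_image[OF T(1)] openin_sph_Some) simp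
  have xU: "x \<in> U" using d T by (auto simp: U_def E_def intro!: image_eqI[of _ _ 0])
  have "normal_on G U"
    unfolding normal_on_def
  proof (intro allI impI)
    fix f :: "nat \<Rightarrow> sphere \<Rightarrow> sphere" assume f: "\<forall>n. f n \<in> G"
    have "\<exists>l r. l \<in> UNIV \<and> strict_mono (r :: nat \<Rightarrow> nat) \<and>
        limitin sph.mtopology ((\<lambda>n. f n x) \<circ> r) l sequentially"
      using compact_sph unfolding sph_top_eq sph.compact_space_sequentially by blast
    then obtain p r where r: "strict_mono (r :: nat \<Rightarrow> nat)"
      and lim: "\<And>e. e > 0 \<Longrightarrow> \<exists>N. \<forall>n\<ge>N. sdist (f (r n) x) p < e"
      unfolding sph.limit_metric_sequentially by auto
    obtain N where N: "\<And>n. n \<ge> N \<Longrightarrow> sdist (f (r n) x) p < 1/2"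
      using lim[of "1/2"] by auto
    obtain S S' where S: "rotation_pair S S'" "S (Some 0) = p" "S' p = Some 0"
      using rotation_pair_zero[of p] .
    have SS': "S (S' s) = s" "sdist (S s) (S t) = sdist s t" for s t
      using S(1) by (simp_all add: rotation_pair_def)
    have isoS': "sdist (S' s) (S' t) = sdist s t" for s t
      using rotation_pair_sym[OF S(1)] by (simp add: rotation_pair_def)
    \<comment> \<open>The shift by N discards the terms whose value at x is still far from
      p.\<close>
    define H where "H n = S' \<circ> (f (r (n + N)) \<circ> E)" for n
    have H: "sph_holomorphic_on (H n) UNIV" for n
      using hol f E S(1) by (simp add: H_def sph_holomorphic_map_def rotation_pair_def)
    have Hsmall: "\<exists>y. H n z = Some y \<and> cmod y \<le> 1" if z: "z \<in> ball 0 d" for n z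
    proof -
      have "E z \<in> W" using d z by auto
      then have "sdist (f (r (n + N)) x) (f (r (n + N)) (E z)) < 1/2" using small f by blast
      moreover have "sdist (f (r (n + N)) x) p < 1/2" using N by simp
      ultimately have "sdist p (f (r (n + N)) (E z)) < 1"
        using sph.triangle[of p "f (r (n + N)) x" "f (r (n + N)) (E z)"]
          sph.commute[of p "f (r (n + N)) x"] by simp
      then have "sdist (Some 0) (H n z) < 1"
        using isoS'[of p] S(3) by (simp add: H_def)
      then show ?thesis using sdist_zero_less_1 by blast
    qed
    define h where "h n z = the (H n z)" for n z
    have Hh: "H n z = Some (h n z)" "cmod (h n z) \<le> 1" if "z \<in> ball 0 d" for n z
      using Hsmall[OF that, of n] by (auto simp: h_def)
    have hhol: "h n holomorphic_on ball 0 d" for n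
      unfolding h_def using Hh(1)
      by (intro holomorphic_on_the sph_holomorphic_on_subset[OF H]) auto
    define \<H> where "\<H> = {k. k holomorphic_on ball 0 d \<and> (\<forall>z\<in>ball 0 d. cmod (k z) \<le> 1)}"
    obtain k r' where r': "strict_mono (r' :: nat \<Rightarrow> nat)"
      and uni: "\<And>K. compact K \<Longrightarrow> K \<subseteq> ball 0 d \<Longrightarrow> uniform_limit K (h \<circ> r') k sequentially"
    proof (rule Montel[of "ball 0 d" \<H> h])
      show "\<exists>B. \<forall>h\<in>\<H>. \<forall>z\<in>K. cmod (h z) \<le> B" if "compact K" "K \<subseteq> ball 0 d" for K
        using that by (intro exI[of _ 1]) (auto simp: \<H>_def)
      show "range h \<subseteq> \<H>" using hhol Hh(2) by (auto simp: \<H>_def)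
    qed (auto simp: \<H>_def)
    have "cball 0 (d/2) \<subseteq> ball 0 d" using d(1) by auto
    then have unif: "uniform_limit (cball 0 (d/2)) (h \<circ> r') k sequentially"
      by (intro uni) auto
    define \<psi> where "\<psi> w = S (Some (k (the (T' w))))" for w
    define r2 where "r2 n = r (r' n + N)" for n
    have "strict_mono r2"
      using r r' by (simp add: r2_def strict_mono_def)
    moreover have "\<exists>M. \<forall>n\<ge>M. \<forall>w\<in>U. sdist (f (r2 n) w) (\<psi> w) < e" if "e > 0" for e
    proof -
      have "\<forall>\<^sub>F n in sequentially. \<forall>z\<in>cball 0 (d/2). dist ((h \<circ> r') n z) (k z) < e/2"
        using uniform_limitD[OF unif, of "e/2"] that by simp
      then obtain M where M: "\<And>n z. n \<ge> M \<Longrightarrow> z \<in> cball 0 (d/2) \<Longrightarrow> cmod (h (r' n) z - k z) < e/2"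
        unfolding eventually_sequentially comp_apply dist_norm by blast
      have "sdist (f (r2 n) w) (\<psi> w) < e" if n: "n \<ge> M" and w: "w \<in> U" for n w
      proof -
        obtain z where z: "z \<in> ball 0 (d/2)" "w = E z" using w unfolding U_def by blast
        then have zd: "z \<in> ball 0 d" "z \<in> cball 0 (d/2)" using d(1) by auto
        have "S' (f (r2 n) w) = Some (h (r' n) z)"
          using Hh(1)[OF zd(1), of "r' n"] by (simp add: H_def r2_def z)
        then have "f (r2 n) w = S (Some (h (r' n) z))" using SS'(1) by metis
        moreover have "\<psi> w = S (Some (k z))" by (simp add: \<psi>_def z E_def TT')
        ultimately have "sdist (f (r2 n) w) (\<psi> w) = sdist (Some (h (r' n) z)) (Some (k z))"
          by (simp only: SS'(2))
        also have "\<dots> \<le> 2 * cmod (h (r' n) z - k z)" by (rule sdist_Some_le)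
        also have "\<dots> < e" using M[OF n zd(2)] by simp
        finally show ?thesis .
      qed
      then show ?thesis by blast
    qed
    ultimately show "\<exists>(r :: nat \<Rightarrow> nat) \<phi>. strict_mono r \<and> (\<forall>z\<in>U. \<exists>V. openin sph_top V \<and> z \<in> V \<and> V \<subseteq> U \<and>
              (\<forall>e>0. \<exists>N. \<forall>n\<ge>N. \<forall>w\<in>V. sdist (f (r n) w) (\<phi> w) < e))"
      using U by (intro exI[of _ r2] exI[of _ \<psi>]) blast
  qed
  then show ?thesis using U xU unfolding fatou_set_def by blast
qed

text \<open>The complement of the ball is connected and misses \<Gamma>, so it cannot meet both of
  the open sets W and \<open>UNIV - (W \<union> \<Gamma>)\<close>.\<close>

lemma open_set_with_small_frontier:
  assumes W: "openin sph_top W" and cl: "closedin sph_top (W \<union> \<Gamma>)"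
    and \<Gamma>: "\<And>w. w \<in> \<Gamma> \<Longrightarrow> sdist p w < e" and e: "e > 0"
  shows "(\<forall>w\<in>W. sdist p w < e) \<or> (\<forall>w. e \<le> sdist p w \<longrightarrow> w \<in> W)"
proof (rule ccontr)
  assume neg: "\<not> ?thesis"
  have op: "openin sph_top (UNIV - (W \<union> \<Gamma>))"
    using openin_diff[OF openin_topspace cl] by simp
  have *: "w \<notin> \<Gamma>" if "e \<le> sdist p w" for w using \<Gamma>[of w] that by auto
  show False
    by (rule connectedinD[OF connectedin_sball_complement[OF e, of p] W op])
      (use neg * in \<open>auto simp: not_less not_le\<close>)
qed

text \<open>Every admissible M dominates each difference quotient, hence so does the infimum, once
  the set of admissible M is known to be nonempty.\<close>

lemma Lip_bound:
  assumes "nonconst_rational_map f" "Lip f \<le> C"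
  shows "sdist (f z) (f w) \<le> C * sdist z w"
proof -
  obtain N p q where f: "f = hmap N p q" "hgood N p q" using rational_map_hmap[OF assms(1)] by metis
  obtain L where "L > 0" and L: "\<And>s t. sdist (hmap N p q s) (hmap N p q t) \<le> L * sdist s t"
    using hmap_Lipschitz[OF f(2)] by metis
  define X where "X = {M. \<forall>z w. sdist (f z) (f w) \<le> M * sdist z w}"
  have "X \<noteq> {}" using L by (auto simp: X_def f(1))
  show ?thesis
  proof (cases "z = w")
    case False
    then have pos: "sdist z w > 0" by simp
    have "sdist (f z) (f w) / sdist z w \<le> Inf X"
    proof (rule cInf_greatest[OF \<open>X \<noteq> {}\<close>])
      fix M assume "M \<in> X"
      then show "sdist (f z) (f w) / sdist z w \<le> M"
        using pos by (simp add: X_def divide_le_eq)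
    qed
    also have "\<dots> \<le> C" using assms(2) by (simp add: Lip_def X_def)
    finally show ?thesis using pos by (simp add: divide_le_eq)
  qed simp
qed

text \<open>For finite modulus the hypothesis says that ln(r2/r1) exceeds 2L, so there is room for a
  factor exp L on either side of \<rho>. The core need not be central: \<rho> is placed at
  logarithmic distance L from a positive inner radius, or else from a finite outer radius, and at 1
  in the punctured plane.\<close>

lemma annulus_core:
  assumes r: "0 \<le> r1" "r1 < r2" and m: "ereal (L / pi) < annulus_modulus r1 r2"
  obtains \<rho> where "\<rho> > 0"
    "\<And>z. \<rho> * exp (- L) < cmod z \<Longrightarrow> cmod z < \<rho> * exp L \<Longrightarrow> z \<in> round_annulus r1 r2"
proof -
  obtain a where a: "r1 = ereal a" "a \<ge> 0" using r by (cases r1) auto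
  consider "r2 = \<infinity>" "a = 0" | "r2 = \<infinity>" "a > 0" | b where "r2 = ereal b" "a = 0" "b > 0"
    | b where "r2 = ereal b" "a > 0" "b > a"
    using a r by (cases r2) (auto simp: le_less)
  then show ?thesis
  proof cases
    case 1
    show ?thesis
      by (rule that[of 1]) (auto simp: round_annulus_def a 1 intro: le_less_trans[of 0 "exp (- L)"])
  next
    case 2
    show ?thesis
      by (rule that[of "a * exp L"]) (use 2 in \<open>auto simp: round_annulus_def a exp_minus mult.assoc\<close>)
  next
    case 3
    show ?thesis
    proof (rule that[of "b * exp (- L)"])
      fix z assume z: "b * exp (- L) * exp (- L) < cmod z" "cmod z < b * exp (- L) * exp L"
      have "0 < b * exp (- L) * exp (- L)" using 3 by simp
      then have "cmod z > 0" using z(1) by linarith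
      moreover have "cmod z < b" using z(2) by (simp add: exp_minus mult.assoc)
      ultimately show "z \<in> round_annulus r1 r2" by (simp add: round_annulus_def a 3)
    qed (use 3 in simp)
  next
    case 4
    have "L / pi < ln (b / a) / (2 * pi)" using m a 4 by (simp add: annulus_modulus_def)
    then have "2 * L < ln (b / a)" by (simp add: field_simps)
    then have "exp (2 * L) < exp (ln (b / a))" by simp
    also have "\<dots> = b / a" using 4 by simp
    finally have *: "a * exp L * exp L < b" using 4 by (simp add: field_simps flip: exp_double power2_eq_square)
    show ?thesis
    proof (rule that[of "a * exp L"])
      fix z assume z: "a * exp L * exp (- L) < cmod z" "cmod z < a * exp L * exp L"
      have "a < cmod z" using z(1) by (simp add: exp_minus mult.assoc)
      moreover have "cmod z < b" using z(2) * by simp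
      ultimately show "z \<in> round_annulus r1 r2" by (simp add: round_annulus_def a 4)
    qed (use 4 in simp)
  qed
qed

subsection \<open>Uniform perfectness\<close>

lemma continuous_map_sph_Lipschitz:
  assumes "\<And>s t. sdist (f s) (f t) \<le> C * sdist s t"
  shows "continuous_map sph_top sph_top f"
  unfolding continuous_map_def
proof (intro conjI allI impI)
  fix U assume U: "openin sph_top U"
  show "openin sph_top {x \<in> topspace sph_top. f x \<in> U}"
    unfolding openin_sph
  proof
    fix z assume "z \<in> {x \<in> topspace sph_top. f x \<in> U}"
    then obtain e where e: "e > 0" "\<And>w. sdist (f z) w < e \<Longrightarrow> w \<in> U"
      using U unfolding openin_sph by blast
    define D where "D = \<bar>C\<bar> + 1"
    have D: "D > 0" "C \<le> D" by (auto simp: D_def)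
    have "f w \<in> U" if w: "sdist z w < e / D" for w
    proof (rule e(2))
      have "sdist (f z) (f w) \<le> C * sdist z w" by (rule assms)
      also have "\<dots> \<le> D * sdist z w" using D by (intro mult_right_mono) auto
      also have "\<dots> < e" using w D by (simp add: field_simps)
      finally show "sdist (f z) (f w) < e" .
    qed
    then show "\<exists>e>0. \<forall>w. sdist z w < e \<longrightarrow> w \<in> {x \<in> topspace sph_top. f x \<in> U}"
      using e(1) D(1) by (intro exI[of _ "e / D"]) auto
  qed
qed auto

text \<open>Finite fibres are used for the generators only; openness itself is what passes to
  compositions.\<close>

lemma gen_semigroup_regular:
  assumes gen: "\<And>i. i \<in> I \<Longrightarrow> nonconst_rational_map (g i)" and f: "f \<in> gen_semigroup g I"
  shows "sph_holomorphic_map f \<and> continuous_map sph_top sph_top f \<and>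
    (\<forall>U. openin sph_top U \<longrightarrow> openin sph_top (f ` U))"
  using f
proof induction
  case (gen i)
  obtain N p q where f: "g i = hmap N p q" "hgood N p q" and fin: "\<And>w. finite {z. g i z = w}"
    using rational_map_hmap[OF assms(1)[OF gen]] by metis
  have hol: "sph_holomorphic_map (g i)" using f sph_holomorphic_map_hmap by simp
  moreover have "continuous_map sph_top sph_top (g i)"
    using hmap_Lipschitz[OF f(2)] continuous_map_sph_Lipschitz unfolding f(1) by metis
  ultimately show ?case using openin_rational_image[OF hol fin] by blast
next
  case (comp f h)
  show ?case
  proof (intro conjI allI impI)
    show "sph_holomorphic_map (f \<circ> h)" "continuous_map sph_top sph_top (f \<circ> h)"
      using sph_holomorphic_map_comp[of f h] continuous_map_compose[of sph_top sph_top h sph_top f]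
        comp.IH by simp_all
    show "openin sph_top ((f \<circ> h) ` U)" if "openin sph_top U" for U
      using comp.IH that by (simp only: image_comp[symmetric])
  qed
qed

theorem theorem3p1:
  fixes g :: "'i \<Rightarrow> sphere \<Rightarrow> sphere" and I :: "'i set" and C :: real
  assumes "\<forall>i\<in>I. nonconst_rational_map (g i)"
    and "non_elementary (gen_semigroup g I)"
    and "\<forall>i\<in>I. Lip (g i) \<le> C"
  shows "uniformly_perfect (julia_set (gen_semigroup g I))"
proof -
  define G where "G = gen_semigroup g I"
  define J where "J = julia_set G"
  have reg: "sph_holomorphic_map f" "continuous_map sph_top sph_top f"
    "\<And>U. openin sph_top U \<Longrightarrow> openin sph_top (f ` U)" if "f \<in> G" for f
    using gen_semigroup_regular[of I g f] assms(1) that by (auto simp: G_def)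
  have inv: "f z \<notin> J" if "f \<in> G" "z \<notin> J" for f z
    using fatou_forward_invariant[of f G z] reg(3)[OF that(1)] that gen_semigroup.comp[of _ g I f]
    by (auto simp: J_def julia_set_def G_def)
  obtain a b c where abc: "a \<in> J" "b \<in> J" "c \<in> J" "a \<noteq> b" "a \<noteq> c" "b \<noteq> c"
    using assms(2) unfolding non_elementary_def J_def G_def by blast
  define \<delta> where "\<delta> = min (sdist a b) (min (sdist a c) (sdist b c))"
  have \<delta>: "\<delta> > 0" "\<delta> \<le> sdist a b" "\<delta> \<le> sdist a c" "\<delta> \<le> sdist b c"
    using abc by (auto simp: \<delta>_def)
  \<comment> \<open>With \<open>D \<ge> 1\<close> the single bound
    \<open>D * (2 * \<eta>) < \<delta>\<close> also gives
    \<open>2 * \<eta> < \<delta>\<close>.\<close>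
  define D where "D = max C 1"
  have D: "D \<ge> 1" "C \<le> D" by (auto simp: D_def)
  have lip: "sdist (g i z) (g i w) \<le> D * sdist z w" if "i \<in> I" for i z w
    using Lip_bound[of "g i" D z w] assms(1,3) that D(2) by fastforce
  \<comment> \<open>The bound 1/4 serves the normality criterion, which needs
    \<open>2 * \<eta> \<le> 1/2\<close>; the other makes a generator map sets inside a ball of
    radius \<eta> to sets of diameter at most \<open>\<delta> / 2\<close>.\<close>
  define \<eta> where "\<eta> = min (1/4) (\<delta> / (4 * D))"
  have \<eta>: "\<eta> > 0" "2 * \<eta> \<le> 1/2" using \<delta> D by (auto simp: \<eta>_def)
  have \<eta>D: "D * (2 * \<eta>) < \<delta>"
  proof -
    have "D * (2 * \<eta>) \<le> D * (2 * (\<delta> / (4 * D)))"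
      using D by (intro mult_left_mono) (auto simp: \<eta>_def)
    also have "\<dots> = \<delta> / 2" using D by simp
    finally show ?thesis using \<delta>(1) by simp
  qed
  have \<eta>2: "2 * \<eta> < \<delta>"
  proof -
    have "1 * (2 * \<eta>) \<le> D * (2 * \<eta>)" using D \<eta>(1) by (intro mult_right_mono) auto
    then show ?thesis using \<eta>D by linarith
  qed
  obtain K where K: "K > 0"
    "\<And>F \<rho> L z. sph_holomorphic_on F {z. \<rho> * exp (- L) < cmod z \<and> cmod z < \<rho> * exp L} \<Longrightarrow>
       \<forall>z. \<rho> * exp (- L) < cmod z \<and> cmod z < \<rho> * exp L \<longrightarrow> F z \<noteq> a \<and> F z \<noteq> b \<and> F z \<noteq> c \<Longrightarrow>
       \<rho> > 0 \<Longrightarrow> L \<ge> 8 * pi \<Longrightarrow> cmod z = \<rho> \<Longrightarrow> sdist (F (of_real \<rho>)) (F z) \<le> K / L"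
    using core_circle_small[OF abc(4-6)] by blast
  \<comment> \<open>The first entry is the threshold of the core circle estimate; the factor 2 in
    the second makes \<open>K / L < \<eta>\<close> strict.\<close>
  define L where "L = max (8 * pi) (2 * K / \<eta>)"
  have L: "L \<ge> 8 * pi" "L > 0" by (auto simp: L_def intro: less_le_trans[of 0 "8 * pi"])
  have KL: "K / L < \<eta>"
  proof -
    have "2 * K \<le> \<eta> * L" using \<eta>(1) by (simp add: L_def max_def field_simps)
    then show ?thesis using L(2) K(1) by (simp add: divide_less_eq)
  qed
  have "annulus_modulus r1 r2 \<le> ereal (L / pi)"
    if ann: "conformal_annulus A r1 r2" and sep: "separates A J" for A r1 r2
  proof (rule ccontr)
    assume "\<not> ?thesis"
    then have mod: "ereal (L / pi) < annulus_modulus r1 r2" by simp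
    obtain \<phi> where \<phi>: "bij_betw \<phi> (round_annulus r1 r2) A" "sph_holomorphic_on \<phi> (round_annulus r1 r2)"
      and r: "0 \<le> r1" "r1 < r2"
      using ann unfolding conformal_annulus_def by blast
    have A: "A = \<phi> ` round_annulus r1 r2" "inj_on \<phi> (round_annulus r1 r2)"
      using \<phi>(1) by (auto simp: bij_betw_def)
    obtain x y where xy: "x \<in> J" "y \<in> J"
      "\<not> connected_component_of (subtopology sph_top (UNIV - A)) x y" and AJ: "J \<inter> A = {}"
      using sep unfolding separates_def by blast
    obtain \<rho> where \<rho>: "\<rho> > 0"
      "\<And>z. \<rho> * exp (- L) < cmod z \<Longrightarrow> cmod z < \<rho> * exp L \<Longrightarrow> z \<in> round_annulus r1 r2"
      using annulus_core[OF r mod] by blast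
    define \<Gamma> where "\<Gamma> = \<phi> ` {z. cmod z = \<rho>}"
    define q where "q = \<phi> (of_real \<rho>)"
    define R where "R = {z. \<rho> * exp (- L) < cmod z \<and> cmod z < \<rho> * exp L}"
    have Rsub: "R \<subseteq> round_annulus r1 r2" using \<rho>(2) by (auto simp: R_def)
    have "open R" unfolding R_def by (intro open_Collect_conj open_Collect_less continuous_intros)
    then have \<phi>R: "sph_holomorphic_on \<phi> R" by (rule sph_holomorphic_on_subset[OF \<phi>(2) Rsub])
    have circ: "{z. cmod z = \<rho>} \<subseteq> R"
      using \<rho>(1) L(2) by (auto simp: R_def)
    then have circ_ann: "{z. cmod z = \<rho>} \<subseteq> round_annulus r1 r2" using Rsub by blast
    have "of_real \<rho> \<in> {z. cmod z = \<rho>}" using \<rho>(1) by simp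
    then have "of_real \<rho> \<in> round_annulus r1 r2" using circ_ann by blast
    then have \<rho>r: "r1 < ereal \<rho>" "ereal \<rho> < r2"
      using \<rho>(1) by (simp_all add: round_annulus_def)
    have \<phi>J: "\<phi> z \<notin> J" if "z \<in> R" for z using AJ A(1) Rsub that by blast
    \<comment> \<open>The identity is included to locate the core curve itself, which is the start
      of the induction.\<close>
    have small: "sdist (f q) (f w) < \<eta>" if f: "f = id \<or> f \<in> G" and w: "w \<in> \<Gamma>" for f w
    proof -
      obtain z where z: "cmod z = \<rho>" "w = \<phi> z" using w by (auto simp: \<Gamma>_def)
      have hol: "sph_holomorphic_on (f \<circ> \<phi>) R"
        using f \<phi>R reg(1) by (auto simp: sph_holomorphic_map_def)
      have om: "(f \<circ> \<phi>) z \<noteq> a \<and> (f \<circ> \<phi>) z \<noteq> b \<and> (f \<circ> \<phi>) z \<noteq> c" if "z \<in> R" for z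
      proof -
        have "(f \<circ> \<phi>) z \<notin> J" using f inv \<phi>J[OF that] by auto
        then show ?thesis using abc by metis
      qed
      have "sdist ((f \<circ> \<phi>) (of_real \<rho>)) ((f \<circ> \<phi>) z) \<le> K / L"
      proof (rule K(2)[OF hol[unfolded R_def] _ \<rho>(1) L(1) z(1)], intro allI impI om)
        show "z \<in> R" if "\<rho> * exp (- L) < cmod z \<and> cmod z < \<rho> * exp L" for z
          using that by (simp add: R_def)
      qed
      then show ?thesis using KL by (simp add: q_def z(2))
    qed
    obtain W1 W2 where W: "openin sph_top W1" "openin sph_top W2" "W1 \<inter> W2 = {}" "x \<in> W1" "y \<in> W2"
      "W1 \<union> W2 = UNIV - \<Gamma>"
    proof (rule core_circle_separates[OF r(1) \<phi>(2) A(2) _ _ _ \<rho>r, of x y])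
      show "x \<notin> \<phi> ` round_annulus r1 r2" "y \<notin> \<phi> ` round_annulus r1 r2"
        using AJ xy A(1) by auto
    qed (use xy(3) A(1) in \<open>auto simp: \<Gamma>_def\<close>)
    have cl1: "closedin sph_top (W1 \<union> \<Gamma>)"
    proof -
      have "W1 \<union> \<Gamma> = UNIV - W2" using W(3,6) by blast
      then show ?thesis using closedin_diff[OF closedin_topspace W(2)] by simp
    qed
    have cl2: "closedin sph_top (W2 \<union> \<Gamma>)"
    proof -
      have "W2 \<union> \<Gamma> = UNIV - W1" using W(3,6) by blast
      then show ?thesis using closedin_diff[OF closedin_topspace W(1)] by simp
    qed
    \<comment> \<open>If \<open>W1\<close> is not inside the ball it contains the complement of the
      ball, and then the disjoint set \<open>W2\<close> is inside.\<close>
    have "(\<forall>w\<in>W1. sdist q w < \<eta>) \<or> (\<forall>w\<in>W2. sdist q w < \<eta>)"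
    proof -
      have "sdist q w < \<eta>" if "w \<in> \<Gamma>" for w using small[of id w] that by simp
      from open_set_with_small_frontier[OF W(1) cl1 this \<eta>(1)]
      have "(\<forall>w\<in>W1. sdist q w < \<eta>) \<or> (\<forall>w. \<eta> \<le> sdist q w \<longrightarrow> w \<in> W1)" by blast
      then show ?thesis using W(3) by (meson disjoint_iff not_le)
    qed
    then have "\<exists>W x'. openin sph_top W \<and> closedin sph_top (W \<union> \<Gamma>) \<and> x' \<in> J \<and> x' \<in> W \<and>
        (\<forall>w\<in>W. sdist q w < \<eta>)"
    proof
      assume "\<forall>w\<in>W1. sdist q w < \<eta>"
      then show ?thesis using W(1,4) cl1 xy(1) by (intro exI[of _ W1] exI[of _ x]) blast
    next
      assume "\<forall>w\<in>W2. sdist q w < \<eta>"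
      then show ?thesis using W(2,5) cl2 xy(2) by (intro exI[of _ W2] exI[of _ y]) blast
    qed
    then obtain W x' where W': "openin sph_top W" "closedin sph_top (W \<union> \<Gamma>)" "x' \<in> J" "x' \<in> W"
      "\<forall>w\<in>W. sdist q w < \<eta>"
      by (elim exE conjE)
    \<comment> \<open>The bound for h enters only to exclude the large alternative for f; the radius
      \<eta> for f comes from the core curve.\<close>
    have Wsmall: "\<forall>w\<in>W. sdist (f q) (f w) < \<eta>" if step: "f = g i \<circ> h" "i \<in> I" "h = id \<or> h \<in> G"
      and h: "\<forall>w\<in>W. sdist (h q) (h w) < \<eta>" for f h i
    proof -
      have fG: "f \<in> G"
        using step gen_semigroup.gen[of i I g] gen_semigroup.comp[of "g i" g I h] by (auto simp: G_def)
      have "compactin sph_top (W \<union> \<Gamma>)" using W'(2) by (rule closedin_compact_space[OF compact_sph])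
      then have "closedin sph_top (f ` (W \<union> \<Gamma>))"
        using reg(2)[OF fG] by (intro compactin_imp_closedin Hausdorff_sph image_compactin)
      then have "(\<forall>w\<in>f ` W. sdist (f q) w < \<eta>) \<or> (\<forall>w. \<eta> \<le> sdist (f q) w \<longrightarrow> w \<in> f ` W)"
        using small[of f] fG
        by (intro open_set_with_small_frontier[OF reg(3)[OF fG W'(1)] _ _ \<eta>(1), of "f ` \<Gamma>"])
          (auto simp only: image_Un)
      moreover have False if big: "\<forall>w. \<eta> \<le> sdist (f q) w \<longrightarrow> w \<in> f ` W"
      proof -
        have near: "sdist u v < \<delta>" if uv: "u \<in> f ` W" "v \<in> f ` W" for u v
        proof -
          obtain s t where st: "s \<in> W" "t \<in> W" "u = g i (h s)" "v = g i (h t)"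
            using uv step(1) by auto
          have "sdist (h s) (h t) \<le> sdist (h s) (h q) + sdist (h q) (h t)" by (simp add: sph.triangle)
          also have "\<dots> \<le> 2 * \<eta>"
            using h[rule_format, OF st(1)] h[rule_format, OF st(2)] sph.commute[of "h s" "h q"] by simp
          finally have "D * sdist (h s) (h t) \<le> D * (2 * \<eta>)" using D by (intro mult_left_mono) auto
          then show ?thesis using lip[OF step(2), of "h s" "h t"] \<eta>D st by simp
        qed
        have far: "u \<in> f ` W \<or> v \<in> f ` W" if "\<delta> \<le> sdist u v" for u v
        proof (rule ccontr)
          assume "\<not> ?thesis"
          then have "sdist (f q) u < \<eta>" "sdist (f q) v < \<eta>" using big not_le by blast+
          then show False
            using that sph.triangle[of u "f q" v] sph.commute[of u "f q"] \<eta>2 by simp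
        qed
        have "\<not> (u \<in> f ` W \<and> v \<in> f ` W)" if "\<delta> \<le> sdist u v" for u v
          using near[of u v] that by linarith
        from this[OF \<delta>(2)] this[OF \<delta>(3)] this[OF \<delta>(4)] far[OF \<delta>(2)] far[OF \<delta>(3)] far[OF \<delta>(4)]
        show False by blast
      qed
      ultimately show ?thesis by auto
    qed
    \<comment> \<open>The semigroup induction splits a word at an arbitrary place, while the
      Lipschitz step adds one generator on the left. Quantifying over the right factor h reconciles
      the two.\<close>
    have all: "\<forall>h. (h = id \<or> h \<in> G) \<longrightarrow> (\<forall>w\<in>W. sdist (h q) (h w) < \<eta>) \<longrightarrow>
        (\<forall>w\<in>W. sdist ((f \<circ> h) q) ((f \<circ> h) w) < \<eta>)" if "f \<in> gen_semigroup g I" for f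
      using that
    proof induction
      case (gen i)
      then show ?case using Wsmall[OF refl gen] by blast
    next
      case (comp f1 f2)
      show ?case
      proof (intro allI impI)
        fix h assume h: "h = id \<or> h \<in> G" "\<forall>w\<in>W. sdist (h q) (h w) < \<eta>"
        have "f2 \<circ> h \<in> G"
          using h(1) comp.hyps gen_semigroup.comp[of f2 g I h] by (auto simp: G_def)
        moreover have "\<forall>w\<in>W. sdist ((f2 \<circ> h) q) ((f2 \<circ> h) w) < \<eta>"
          using comp.IH(2) h by blast
        ultimately have "\<forall>w\<in>W. sdist ((f1 \<circ> (f2 \<circ> h)) q) ((f1 \<circ> (f2 \<circ> h)) w) < \<eta>"
          using comp.IH(1) by blast
        then show "\<forall>w\<in>W. sdist ((f1 \<circ> f2 \<circ> h) q) ((f1 \<circ> f2 \<circ> h) w) < \<eta>"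
          by (simp add: comp_assoc)
      qed
    qed
    have allG: "sdist (f q) (f w) < \<eta>" if "f \<in> G" "w \<in> W" for f w
      using all[of f] that W'(5) by (auto simp: G_def dest!: spec[of _ id])
    have "x' \<in> fatou_set G"
    proof (rule normal_of_small_images[OF reg(1) W'(1,4)])
      fix f w assume "f \<in> G" "w \<in> W"
      then have "sdist (f q) (f x') < \<eta>" "sdist (f q) (f w) < \<eta>" using allG W'(4) by auto
      then show "sdist (f x') (f w) < 1/2"
        using sph.triangle[of "f x'" "f q" "f w"] sph.commute[of "f x'" "f q"] \<eta>(2) by simp
    qed
    then show False using W'(3) by (simp add: J_def julia_set_def)
  qed
  then show ?thesis
    unfolding uniformly_perfect_def J_def[symmetric] G_def[symmetric]
    using compactin_julia[of G] abc(1,2,4) unfolding J_def by blast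
qed

end
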